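(* Consider $SU(2)$ with its $\mathbf{k}\oplus\mathbf{p}$ sub-Riemannian structure and let $d$ be the associated sub-Riemannian distance. Let $g=\begin{pmatrix}\alpha&\beta\\-\overline{\beta}&\overline{\alpha}\end{pmatrix}\in SU(2)$, i.e. $\alpha,\beta\in\mathbb{C}$, $|\alpha|^2+|\beta|^2=1$. Its sub-Riemannian distance from $\mathrm{Id}$ is $$d(g,\mathrm{Id})=\begin{cases}2\sqrt{\arg(\alpha)\,(2\pi-\arg(\alpha))}&\text{if }\beta=0,\\ \psi(\alpha)&\text{if }\beta\neq0,\end{cases}$$ where $\arg(\alpha)\in[0,2\pi]$ and $\psi(\alpha)=t$ is the unique solution of the system (in the unknowns $c\in\mathbb{R}$ and $t$) $$\begin{cases}-\frac{ct}{2}+\arctan\left(\frac{c}{\sqrt{1+c^2}}\tan\left(\frac{\sqrt{1+c^2}\,t}{2}\right)\right)=\arg(\alpha),\\[1mm] \frac{\sin\left(\frac{\sqrt{1+c^2}\,t}{2}\right)}{\sqrt{1+c^2}}=\sqrt{1-|\alpha|^2},\\[1mm] t\in\left(0,\frac{2\pi}{\sqrt{1+c^2}}\right).\end{cases}$$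
   Context: In $su(2)$ let $p_1=\frac12\begin{pmatrix}0&1\\-1&0\end{pmatrix}$, $p_2=\frac12\begin{pmatrix}0&i\\i&0\end{pmatrix}$, $k=\frac12\begin{pmatrix}i&0\\0&-i\end{pmatrix}$, $\mathbf{k}=\mathrm{span}\{k\}$, $\mathbf{p}=\mathrm{span}\{p_1,p_2\}$. The $\mathbf{k}\oplus\mathbf{p}$ sub-Riemannian structure on $SU(2)$ is the left-invariant one with distribution $\Delta(g)=g\mathbf{p}$ and metric $\mathbf{g}_g(v_1,v_2)=\langle g^{-1}v_1,g^{-1}v_2\rangle$, where $\langle\cdot,\cdot\rangle$ is the inner product on $\mathbf{p}$ with $\{p_1,p_2\}$ orthonormal (it equals $-\frac12$ times the Killing form restricted to $\mathbf{p}$). A Lipschitz curve $\gamma:[0,T]\to SU(2)$ is horizontal if $\dot\gamma(t)\in\Delta(\gamma(t))$ for a.e. $t$; its length is $\int_0^T\sqrt{\mathbf{g}_{\gamma(t)}(\dot\gamma(t),\dot\gamma(t))}\,dt$; $d(q_0,q_1)$ is the infimum of lengths of horizontal curves joining $q_0$ and $q_1$.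
   Formalization: In the system, arctan(m tan u) means the branch continued from 0 at u=0 through u=π/2 (the principal value gives no solution for α=-r, 0<r<1), the first equation is equality of angles mod 2π, and it imposes no condition when α=0, where arg(α) is undefined. *)

theory Defs
  imports "HOL-Analysis.Analysis"
begin

section \<open>The group SU(2)\<close>

definition conj_transpose :: "complex^'n^'m \<Rightarrow> complex^'m^'n" where
  "conj_transpose A = (\<chi> i j. cnj (A $ j $ i))"

definition SU2 :: "(complex^2^2) set" where
  "SU2 = {A. A ** conj_transpose A = mat 1 \<and> conj_transpose A ** A = mat 1 \<and> det A = 1}"

definition su2_matrix :: "complex \<Rightarrow> complex \<Rightarrow> complex^2^2" where
  "su2_matrix \<alpha> \<beta> = vector [vector [\<alpha>, \<beta>], vector [- cnj \<beta>, cnj \<alpha>]]"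

lemma su2_matrix_in_SU2:
  assumes "(cmod \<alpha>)\<^sup>2 + (cmod \<beta>)\<^sup>2 = 1"
  shows "su2_matrix \<alpha> \<beta> \<in> SU2"
proof -
  have "of_real ((cmod \<alpha>)\<^sup>2 + (cmod \<beta>)\<^sup>2) = (1::complex)"
    using assms by simp
  then have "\<alpha> * cnj \<alpha> + \<beta> * cnj \<beta> = 1"
    by (simp only: of_real_add complex_norm_square)
  then show ?thesis
    by (simp add: SU2_def su2_matrix_def conj_transpose_def matrix_matrix_mult_def mat_def
        det_2 sum_2 vec_eq_iff forall_2 algebra_simps)
qed

section \<open>The left-invariant sub-Riemannian structure\<close>

definition p1 :: "complex^2^2" where
  "p1 = (1/2) *\<^sub>R vector [vector [0, 1], vector [-1, 0]]"

definition p2 :: "complex^2^2" where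
  "p2 = (1/2) *\<^sub>R vector [vector [0, \<i>], vector [\<i>, 0]]"

definition p_space :: "(complex^2^2) set" where
  "p_space = span {p1, p2}"

text \<open>The inner product on \<^const>\<open>p_space\<close> in which the basis p1, p2 is orthonormal:
  the sum of the products of the coordinates in that basis.\<close>

definition p_inner :: "complex^2^2 \<Rightarrow> complex^2^2 \<Rightarrow> real" where
  "p_inner X Y = (\<Sum>b\<in>{p1, p2}. representation {p1, p2} X b * representation {p1, p2} Y b)"

lemma p_combination_eq_iff:
  "a *\<^sub>R p1 + b *\<^sub>R p2 = c *\<^sub>R p1 + d *\<^sub>R p2 \<longleftrightarrow> a = c \<and> b = d"
  by (auto simp: p1_def p2_def vec_eq_iff forall_2 complex_eq_iff)

lemma p1_neq_p2: "p1 \<noteq> p2"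
  using p_combination_eq_iff[of 1 0 0 1] by simp

lemma independent_p: "independent {p1, p2}"
proof -
  have "p2 \<noteq> 0"
    using p_combination_eq_iff[of 0 1 0 0] by simp
  moreover have "p1 \<notin> span {p2}"
  proof
    assume "p1 \<in> span {p2}"
    then obtain k where "p1 = k *\<^sub>R p2"
      by (auto simp: span_singleton)
    then show False
      using p_combination_eq_iff[of 1 0 0 k] by simp
  qed
  ultimately show ?thesis
    using p1_neq_p2 by (simp add: independent_insert)
qed

lemma p_inner_coordinates:
  "p_inner (a *\<^sub>R p1 + b *\<^sub>R p2) (c *\<^sub>R p1 + d *\<^sub>R p2) = a * c + b * d"
proof -
  have *: "representation {p1, p2} (x *\<^sub>R p1 + y *\<^sub>R p2) p1 = x"
          "representation {p1, p2} (x *\<^sub>R p1 + y *\<^sub>R p2) p2 = y" for x y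
    using p1_neq_p2
    by (simp_all add: representation_add representation_scale representation_basis
        independent_p span_base span_scale)
  show ?thesis
    using p1_neq_p2 by (simp add: p_inner_def *)
qed

definition distribution :: "complex^2^2 \<Rightarrow> (complex^2^2) set" where
  "distribution g = (\<lambda>X. g ** X) ` p_space"

definition metric :: "complex^2^2 \<Rightarrow> complex^2^2 \<Rightarrow> complex^2^2 \<Rightarrow> real" where
  "metric g v w = p_inner (matrix_inv g ** v) (matrix_inv g ** w)"

text \<open>Curves are total functions of which only the values on the interval from 0 to T matter;
  derivatives are therefore taken within that interval. Lipschitz continuity refers to the
  Euclidean distance of the ambient matrix space, which on the compact submanifold
  \<^const>\<open>SU2\<close> is equivalent to the distance of any Riemannian metric.\<close>

definition velocity :: "real \<Rightarrow> (real \<Rightarrow> complex^2^2) \<Rightarrow> real \<Rightarrow> complex^2^2" where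
  "velocity T \<gamma> t = vector_derivative \<gamma> (at t within {0..T})"

definition horizontal :: "real \<Rightarrow> (real \<Rightarrow> complex^2^2) \<Rightarrow> bool" where
  "horizontal T \<gamma> \<longleftrightarrow>
     0 < T \<and> \<gamma> ` {0..T} \<subseteq> SU2 \<and> (\<exists>L. L-lipschitz_on {0..T} \<gamma>) \<and>
     (AE t in lebesgue_on {0..T}.
        \<gamma> differentiable (at t within {0..T}) \<and> velocity T \<gamma> t \<in> distribution (\<gamma> t))"

text \<open>The speed of a horizontal curve is bounded and measurable, so the integral below exists;
  being a Henstock-Kurzweil integral, it ignores the null set on which there is no derivative.\<close>

definition curve_length :: "real \<Rightarrow> (real \<Rightarrow> complex^2^2) \<Rightarrow> real" where
  "curve_length T \<gamma> =
     integral {0..T} (\<lambda>t. sqrt (metric (\<gamma> t) (velocity T \<gamma> t) (velocity T \<gamma> t)))"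

definition sub_riemannian_dist :: "complex^2^2 \<Rightarrow> complex^2^2 \<Rightarrow> real" where
  "sub_riemannian_dist q0 q1 =
     Inf {curve_length T \<gamma> | T \<gamma>. horizontal T \<gamma> \<and> \<gamma> 0 = q0 \<and> \<gamma> T = q1}"

section \<open>The system defining the distance off the vertical subgroup\<close>

text \<open>\<open>arctan_branch m u\<close> is arctan (m tan u) for u in the open interval from 0 to pi, where
  arctan is not the principal value but the branch that starts at 0 for u = 0 and is continued
  through the pole of the tangent at u = pi/2. It is the polar angle of the point
  (cos u, m sin u), see \<open>arctan_branch_eq_Arg\<close> below. For m = 0 this point runs
  through the origin at u = pi/2, and its angle is 0 before and pi after that.\<close>

definition arctan_branch :: "real \<Rightarrow> real \<Rightarrow> real" where
  "arctan_branch m u =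
     (if u < pi/2 then arctan (m * tan u)
      else if u = pi/2 then sgn m * (pi/2)
      else arctan (m * tan u) + (if m \<ge> 0 then pi else - pi))"

lemma arctan_branch_eq_Arg:
  assumes "0 < u" "u < pi"
  shows "arctan_branch m u = Arg (Complex (cos u) (m * sin u))"
proof -
  have s: "sin u > 0"
    using assms by (simp add: sin_gt_zero)
  consider (lt) "u < pi/2" | (eq) "u = pi/2" | (gt) "u > pi/2" by linarith
  then show ?thesis
  proof cases
    case lt
    then have c: "cos u > 0"
      using assms by (simp add: cos_gt_zero)
    define a where "a = arctan (m * tan u)"
    have "- (pi/2) < a" "a < pi/2"
      using arctan_bounded[of "m * tan u"] by (auto simp: a_def)
    then have "cos a > 0"
      by (simp add: cos_gt_zero_pi)
    have "tan a = m * tan u"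
      by (simp add: a_def tan_arctan)
    then have "sin a * cos u = m * sin u * cos a"
      using c \<open>cos a > 0\<close> by (simp add: tan_def field_simps)
    then have "Complex (cos u) (m * sin u) = rcis (cos u / cos a) a"
      using \<open>cos a > 0\<close> by (simp add: complex_eq_iff rcis_def field_simps)
    then have "Arg (Complex (cos u) (m * sin u)) = a"
      using c \<open>cos a > 0\<close> \<open>- (pi/2) < a\<close> \<open>a < pi/2\<close>
      by (intro Arg_unique'[of "cos u / cos a"]) auto
    then show ?thesis
      using lt by (simp add: arctan_branch_def a_def)
  next
    case eq
    have *: "Complex 0 m = rcis \<bar>m\<bar> (sgn m * (pi/2))"
      by (cases "m = 0") (auto simp: complex_eq_iff rcis_def sgn_if)
    have "Arg (Complex 0 m) = sgn m * (pi/2)"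
    proof (cases "m = 0")
      case True
      then show ?thesis using Arg_zero by (simp flip: zero_complex.code)
    next
      case False
      then show ?thesis
        by (intro Arg_unique'[of "\<bar>m\<bar>"] *) (auto simp: sgn_if)
    qed
    moreover have "Complex (cos u) (m * sin u) = Complex 0 m"
      by (simp add: eq)
    moreover have "arctan_branch m u = sgn m * (pi/2)"
      by (simp add: eq arctan_branch_def)
    ultimately show ?thesis
      by metis
  next
    case gt
    then have c: "cos u < 0"
      using assms cos_gt_zero_pi[of "pi - u"] by (simp add: cos_diff)
    define a where "a = arctan (m * tan u)"
    define b where "b = a + (if m \<ge> 0 then pi else - pi)"
    have ca: "- (pi/2) < a" "a < pi/2"
      using arctan_bounded[of "m * tan u"] by (auto simp: a_def)
    then have "cos a > 0"
      by (simp add: cos_gt_zero_pi)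
    have "tan a = m * tan u"
      by (simp add: a_def tan_arctan)
    then have e: "sin a * cos u = m * sin u * cos a"
      using c \<open>cos a > 0\<close> by (simp add: tan_def field_simps)
    have cb: "cos b = - cos a" "sin b = - sin a"
      by (auto simp: b_def cos_diff sin_diff)
    have "tan u < 0"
      using c s by (simp add: tan_def divide_pos_neg)
    then have "m \<ge> 0 \<Longrightarrow> a \<le> 0" "m < 0 \<Longrightarrow> a > 0"
      by (auto simp: a_def mult_nonneg_nonpos mult_neg_neg)
    then have "b \<in> {-pi<..pi}"
      using ca by (auto simp: b_def)
    moreover have "Complex (cos u) (m * sin u) = rcis (- cos u / cos a) b"
      using \<open>cos a > 0\<close> e by (simp add: complex_eq_iff rcis_def cb field_simps)
    ultimately have "Arg (Complex (cos u) (m * sin u)) = b"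
      using c ca \<open>cos a > 0\<close> by (intro Arg_unique'[of "- cos u / cos a"]) (auto simp: divide_pos_pos divide_neg_pos)
    then show ?thesis
      using gt by (simp add: arctan_branch_def a_def b_def)
  qed
qed

text \<open>Equality with the argument of \<open>\<alpha>\<close> is equality of angles: the left-hand side takes
  values of both signs, while the argument is normalised to the interval from 0 to 2 pi. The
  predicate \<^const>\<open>is_Arg\<close> expresses this (see \<open>is_Arg_iff_cong\<close> below), and it holds
  for every angle when \<open>\<alpha> = 0\<close>, where the argument is not determined.\<close>

definition psi_system :: "complex \<Rightarrow> real \<Rightarrow> real \<Rightarrow> bool" where
  "psi_system \<alpha> c t \<longleftrightarrow>
     is_Arg \<alpha> (- (c * t / 2) + arctan_branch (c / sqrt (1 + c\<^sup>2)) (sqrt (1 + c\<^sup>2) * t / 2)) \<and>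
     sin (sqrt (1 + c\<^sup>2) * t / 2) / sqrt (1 + c\<^sup>2) = sqrt (1 - (cmod \<alpha>)\<^sup>2) \<and>
     t \<in> {0<..<2 * pi / sqrt (1 + c\<^sup>2)}"

lemma is_Arg_iff_cong:
  assumes "\<alpha> \<noteq> 0" "is_Arg \<alpha> \<theta>"
  shows "is_Arg \<alpha> x \<longleftrightarrow> (\<exists>n::int. x = \<theta> + of_int n * (2 * pi))"
proof
  assume "is_Arg \<alpha> x"
  then have "exp (\<i> * of_real x) = exp (\<i> * of_real \<theta>)"
    using assms by (simp add: is_Arg_def) (metis mult_left_cancel norm_eq_zero of_real_eq_0_iff)
  then obtain n :: int where "\<i> * of_real x = \<i> * of_real \<theta> + of_int (2 * n) * pi * \<i>"
    by (auto simp: exp_eq)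
  then have "x = \<theta> + of_int n * (2 * pi)"
    by (simp add: complex_eq_iff)
  then show "\<exists>n::int. x = \<theta> + of_int n * (2 * pi)" ..
next
  assume "\<exists>n::int. x = \<theta> + of_int n * (2 * pi)"
  then show "is_Arg \<alpha> x"
    using assms(2) by (auto simp: is_Arg_2pi_iff)
qed

definition psi :: "complex \<Rightarrow> real" where
  "psi \<alpha> = (THE t. \<exists>c. psi_system \<alpha> c t)"

end

theory Submission
  imports Defs
begin

text \<open>A horizontal vector at the matrix with first row (a, b) has first row
  (- b cnj w / 2, a w / 2) and length |w|. Hence the length of a horizontal curve is the length of
  its first entry a in the closed unit disc for the conformal metric
  2 |da| / sqrt (1 - |a|^2), and the distance from the identity becomes the distance
  from 1 in the disc. The end points of the geodesics from the identity define a diffeomorphism of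
  the open disc (the map \<open>chart\<close> below), which gives both the unique solvability of the
  system and a smooth function on the open disc, the time of arrival. By an explicit computation
  this function solves the eikonal equation of the metric, so it is 1-Lipschitz along horizontal
  curves that stay in the open disc. A general curve is first contracted by a factor r < 1, which
  does not increase its length; letting r tend to 1 gives the lower bound, also for end points on
  the boundary circle. The geodesics attain it.\<close>

section \<open>Lipschitz functions and their derivatives\<close>

text \<open>The conformal factor comes from |da| = |b| |w| / 2 and |b| = sqrt (1 - |a|^2). The phase
  of b drops out by the symmetry under conjugation by diagonal matrices, so two real dimensions
  suffice. The obstacle is the circle |a| = 1: the metric is singular there, the identity lies on
  it, and a horizontal curve may meet it at many times. This forces the detour through contracted
  curves. The eikonal equation replaces a theory of minimizers: a function whose differential has
  exactly the norm prescribed by the metric bounds every length from below, and one curve attaining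
  the bound settles the distance. Neither existence of minimizers nor first order optimality
  conditions are invoked; the geodesics enter as explicit curves. Since competitors are merely
  Lipschitz, a fundamental theorem of calculus with an exceptional null set is required.\<close>

lemma has_vector_derivative_imp_LIMSEQ:
  fixes f :: "real \<Rightarrow> 'a::real_normed_vector"
  assumes f: "(f has_vector_derivative D) (at x within S)"
    and h: "h \<longlonglongrightarrow> 0" "\<And>n. h n \<noteq> 0"
    and S: "eventually (\<lambda>n. x + h n \<in> S) sequentially"
  shows "(\<lambda>n. (f (x + h n) - f x) /\<^sub>R h n) \<longlonglongrightarrow> D"
proof -
  have "((\<lambda>y. norm ((f y - f x) /\<^sub>R (y - x) - D)) \<longlongrightarrow> 0) (at x within S)"
  proof (rule Lim_transform_eventually)
    show "((\<lambda>y. norm ((1 / norm (y - x)) *\<^sub>R (f y - (f x + (y - x) *\<^sub>R D)))) \<longlongrightarrow> 0) (at x within S)"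
      using f by (intro tendsto_norm_zero) (simp add: has_vector_derivative_def has_derivative_within)
    show "\<forall>\<^sub>F y in at x within S. norm ((1 / norm (y - x)) *\<^sub>R (f y - (f x + (y - x) *\<^sub>R D)))
        = norm ((f y - f x) /\<^sub>R (y - x) - D)"
      unfolding eventually_at_filter
    proof (intro always_eventually allI impI)
      fix y assume "y \<noteq> x"
      then have "(f y - f x) /\<^sub>R (y - x) - D = (1 / (y - x)) *\<^sub>R (f y - (f x + (y - x) *\<^sub>R D))"
        by (simp add: scaleR_diff_right scaleR_add_right divide_inverse)
      then show "norm ((1 / norm (y - x)) *\<^sub>R (f y - (f x + (y - x) *\<^sub>R D)))
        = norm ((f y - f x) /\<^sub>R (y - x) - D)"
        by simp
    qed
  qed
  moreover have "filterlim (\<lambda>n. x + h n) (at x within S) sequentially"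
    unfolding filterlim_at using S h(2) tendsto_add[OF tendsto_const h(1), of x]
    by (auto elim: eventually_mono)
  ultimately have "(\<lambda>n. norm ((f (x + h n) - f x) /\<^sub>R (x + h n - x) - D)) \<longlonglongrightarrow> 0"
    by (rule filterlim_compose)
  then show ?thesis
    by (simp add: LIM_zero_iff tendsto_norm_zero_iff)
qed

lemma LIMSEQ_divide_Suc: "(\<lambda>n. 1 / real (Suc n)) \<longlonglongrightarrow> 0"
  using LIMSEQ_inverse_real_of_nat by (simp add: inverse_eq_divide)

lemma integral_difference_quotient_LIMSEQ:
  fixes g :: "real \<Rightarrow> 'a::euclidean_space"
  assumes g: "continuous_on UNIV g" and "a \<le> b"
  obtains y where "\<And>n. ((\<lambda>t. (g (t + 1 / Suc n) - g t) /\<^sub>R (1 / Suc n)) has_integral y n) {a..b}"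
    and "y \<longlonglongrightarrow> g b - g a"
proof -
  \<comment> \<open>The primitive starts at \<open>a - 1\<close> so that it has a two-sided
    derivative on \<open>{a..b+1}\<close>, which contains both end points and all shifted points
    \<open>t + 1 / Suc n\<close>.\<close>
  define K where "K u = integral {a-1..u} g" for u
  have K: "(K has_vector_derivative g x) (at x)" if "x \<in> {a..b+1}" for x
  proof -
    have "(K has_vector_derivative g x) (at x within {a-1..b+2})"
      unfolding K_def using that g
      by (intro integral_has_vector_derivative) (auto intro: continuous_on_subset)
    moreover have "x \<in> interior {a-1..b+2}" using that by auto
    ultimately show ?thesis by (metis at_within_interior)
  qed
  define y where "y n = (K (b + 1 / Suc n) - K b) /\<^sub>R (1 / Suc n) - (K (a + 1 / Suc n) - K a) /\<^sub>R (1 / Suc n)" for n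
  show ?thesis
  proof (rule that[of y])
    fix n :: nat
    let ?h = "1 / real (Suc n)"
    have h: "0 < ?h" "?h \<le> 1" by auto
    have "((\<lambda>t. (K (t + ?h) - K t) /\<^sub>R ?h) has_vector_derivative (g (t + ?h) - g t) /\<^sub>R ?h) (at t within {a..b})"
      if t: "t \<in> {a..b}" for t
    proof -
      have "((\<lambda>t. t + ?h) has_vector_derivative 1) (at t)"
        using has_vector_derivative_add[OF has_vector_derivative_id has_vector_derivative_const] by simp
      moreover have "(K has_vector_derivative g (t + ?h)) (at (t + ?h))"
        by (rule K) (use t h in \<open>unfold atLeastAtMost_iff, linarith\<close>)
      ultimately have "((K \<circ> (\<lambda>t. t + ?h)) has_vector_derivative (1 *\<^sub>R g (t + ?h))) (at t)"
        by (rule vector_diff_chain_at)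
      then have 1: "((\<lambda>t. K (t + ?h)) has_vector_derivative g (t + ?h)) (at t within {a..b})"
        by (auto simp: o_def intro: has_vector_derivative_at_within)
      have 2: "(K has_vector_derivative g t) (at t within {a..b})"
        using K[of t] t by (auto intro: has_vector_derivative_at_within)
      show ?thesis
        by (rule bounded_linear.has_vector_derivative[OF bounded_linear_scaleR_right
              has_vector_derivative_diff[OF 1 2]])
    qed
    then have "((\<lambda>t. (g (t + ?h) - g t) /\<^sub>R ?h) has_integral ((K (b + ?h) - K b) /\<^sub>R ?h - (K (a + ?h) - K a) /\<^sub>R ?h)) {a..b}"
      by (intro fundamental_theorem_of_calculus \<open>a \<le> b\<close>)
    then show "((\<lambda>t. (g (t + ?h) - g t) /\<^sub>R ?h) has_integral y n) {a..b}"
      by (simp add: y_def)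
  next
    have "(\<lambda>n. (K (x + 1 / Suc n) - K x) /\<^sub>R (1 / Suc n)) \<longlonglongrightarrow> g x" if "x \<in> {a..b}" for x
      by (rule has_vector_derivative_imp_LIMSEQ[where S = UNIV, OF _ LIMSEQ_divide_Suc])
        (use K that in auto)
    then show "y \<longlonglongrightarrow> g b - g a"
      unfolding y_def using \<open>a \<le> b\<close> by (intro tendsto_diff) auto
  qed
qed

text \<open>The difference quotients of a Lipschitz function are bounded, so that dominated convergence
  applies to them; their integrals are difference quotients of a primitive.\<close>

theorem fundamental_theorem_of_calculus_lipschitz:
  fixes f :: "real \<Rightarrow> 'a::euclidean_space"
  assumes "a \<le> b" and f: "L-lipschitz_on {a..b} f" and N: "negligible N"
    and f': "\<And>t. t \<in> {a..b} - N \<Longrightarrow> (f has_vector_derivative f' t) (at t within {a..b})"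
  shows "(f' has_integral f b - f a) {a..b}" and "f' absolutely_integrable_on {a..b}"
proof -
  \<comment> \<open>Extending \<open>f\<close> by its end values keeps it \<open>L\<close>-Lipschitz
    and gives a meaning to quotients that step beyond \<open>b\<close>.\<close>
  define g where "g t = f (max a (min b t))" for t
  have g_eq: "g t = f t" if "t \<in> {a..b}" for t
    using that by (simp add: g_def)
  have L: "0 \<le> L" using f by (rule lipschitz_on_nonneg)
  have g_lip: "norm (g s - g t) \<le> L * \<bar>s - t\<bar>" for s t
  proof -
    have "norm (g s - g t) \<le> L * \<bar>max a (min b s) - max a (min b t)\<bar>"
      using lipschitz_onD[OF f, of "max a (min b s)" "max a (min b t)"] \<open>a \<le> b\<close>
      by (simp add: g_def dist_norm)
    also have "\<dots> \<le> L * \<bar>s - t\<bar>"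
      using L by (intro mult_left_mono) auto
    finally show ?thesis .
  qed
  then have "L-lipschitz_on UNIV g"
    using L by (simp add: lipschitz_on_def dist_norm)
  then have "continuous_on UNIV g"
    by (rule lipschitz_on_continuous_on)
  then obtain y where
    y: "\<And>n. ((\<lambda>t. (g (t + 1 / Suc n) - g t) /\<^sub>R (1 / Suc n)) has_integral y n) {a..b}"
      "y \<longlonglongrightarrow> g b - g a"
    using integral_difference_quotient_LIMSEQ[OF _ \<open>a \<le> b\<close>] by blast
  \<comment> \<open>The quotients step to the right, so at \<open>b\<close> they see the constant
    extension and not \<open>f' b\<close>; this point is discarded together with
    \<open>N\<close>.\<close>
  define M where "M = insert b N"
  have M: "negligible M"
    using N by (simp add: M_def negligible_insert)
  define D where "D n t = (if t \<in> M then 0 else (g (t + 1 / Suc n) - g t) /\<^sub>R (1 / Suc n))" for n t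
  define d where "d t = (if t \<in> M then 0 else f' t)" for t
  have "norm ((g (t + h) - g t) /\<^sub>R h) \<le> L" if "h > 0" for t h
    using g_lip[of "t + h" t] that by (simp add: inverse_eq_divide pos_divide_le_eq)
  from this[of "1 / Suc n" for n] have D_bound: "norm (D n t) \<le> L" for n t
    using L by (simp add: D_def del: of_nat_Suc)
  have D_lim: "(\<lambda>n. D n t) \<longlonglongrightarrow> d t" if "t \<in> {a..b}" for t
  proof (cases "t \<in> M")
    case False
    then have t: "t \<in> {a..<b}" "t \<in> {a..b} - N" using that by (auto simp: M_def)
    have "(g has_vector_derivative f' t) (at t within {a..b})"
      by (rule has_vector_derivative_transform[OF _ _ f'])
        (use t g_eq in auto)
    moreover have "eventually (\<lambda>n. t + 1 / Suc n \<in> {a..b}) sequentially"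
    proof -
      have "(\<lambda>n. t + 1 / Suc n) \<longlonglongrightarrow> t + 0"
        by (intro tendsto_add tendsto_const LIMSEQ_divide_Suc)
      then have "eventually (\<lambda>n. t + 1 / Suc n < b) sequentially"
        using t by (intro order_tendstoD(2)[of _ "t + 0"]) auto
      then show ?thesis
        by (rule eventually_mono) (use t in \<open>auto intro: order_trans[of a t]\<close>)
    qed
    ultimately have "(\<lambda>n. (g (t + 1 / Suc n) - g t) /\<^sub>R (1 / Suc n)) \<longlonglongrightarrow> f' t"
      by (intro has_vector_derivative_imp_LIMSEQ[where S = "{a..b}"] LIMSEQ_divide_Suc) auto
    then show ?thesis using False by (simp add: D_def d_def)
  qed (simp add: D_def d_def)
  have "(d has_integral g b - g a) {a..b}"
  proof (rule has_integral_dominated_convergence[where f = D and h = "\<lambda>_. L" and y = y])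
    show "(D n has_integral y n) {a..b}" for n
      by (rule has_integral_spike[OF M _ y(1)]) (simp add: D_def)
  qed (use D_bound D_lim y in auto)
  then have d: "(d has_integral f b - f a) {a..b}"
    using g_eq \<open>a \<le> b\<close> by auto
  show "(f' has_integral f b - f a) {a..b}"
    by (rule has_integral_spike[OF M _ d]) (simp add: d_def)
  have "d absolutely_integrable_on {a..b}"
  proof (rule absolutely_integrable_integrable_bound[where g = "\<lambda>_. L"])
    show "norm (d t) \<le> L" if "t \<in> {a..b}" for t
      using D_bound by (intro LIMSEQ_le_const2[OF tendsto_norm[OF D_lim[OF that]]]) auto
  qed (use d in auto)
  then show "f' absolutely_integrable_on {a..b}"
    by (rule absolutely_integrable_spike[OF _ M]) (simp add: d_def)
qed

section \<open>Geodesics in the unit disc\<close>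

definition arc_ratio :: "real \<Rightarrow> real" where
  "arc_ratio x = arccos x / sqrt (1 - x\<^sup>2)"

lemma arc_ratio_cos: "0 < u \<Longrightarrow> u < pi \<Longrightarrow> arc_ratio (cos u) = u / sin u"
  using sin_gt_zero[of u] by (simp add: arc_ratio_def arccos_cos flip: sin_squared_eq)

lemma one_minus_square_pos:
  fixes x :: real
  assumes "\<bar>x\<bar> < 1"
  shows "0 < 1 - x\<^sup>2"
  using assms by (simp add: abs_square_less_1)

lemma arc_ratio_pos: "\<bar>x\<bar> < 1 \<Longrightarrow> 0 < arc_ratio x"
  using one_minus_square_pos[of x] arccos_lt_bounded[of x] by (auto simp: arc_ratio_def abs_less_iff)

text \<open>Equivalent to u / sin u being increasing, that is, to \<open>arc_ratio\<close> being
  decreasing. Both the invertibility of the differential of \<open>chart\<close> and its injectivity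
  on circles rest on this inequality.\<close>

lemma mult_cos_less_sin:
  assumes "0 < u" "u < pi"
  shows "u * cos u < sin u"
proof -
  have "(\<lambda>u. sin u - u * cos u) 0 < (\<lambda>u. sin u - u * cos u) u"
  proof (rule DERIV_pos_imp_increasing_open[OF assms(1)])
    show "\<exists>y. ((\<lambda>u. sin u - u * cos u) has_real_derivative y) (at v) \<and> 0 < y"
      if "0 < v" "v < u" for v
      by (rule exI[of _ "v * sin v"]) (use that assms in \<open>auto intro!: derivative_eq_intros simp: sin_gt_zero\<close>)
  qed (auto intro!: continuous_intros)
  then show ?thesis by simp
qed

lemma mult_arc_ratio_less_1:
  assumes "\<bar>x\<bar> < 1"
  shows "x * arc_ratio x < 1"
proof -
  have u: "0 < arccos x" "arccos x < pi" "cos (arccos x) = x"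
    using assms arccos_lt_bounded[of x] by (auto simp: abs_less_iff)
  have "x * arc_ratio x = arccos x * cos (arccos x) / sin (arccos x)"
    using arc_ratio_cos[OF u(1,2)] u(3) by simp
  also have "\<dots> < 1"
    using mult_cos_less_sin[OF u(1,2)] sin_gt_zero[OF u(1,2)] by simp
  finally show ?thesis .
qed

text \<open>Written through the linear differential equation of \<open>arc_ratio\<close>, so that
  products with 1 - x^2 reduce to polynomials in x and \<open>arc_ratio x\<close>, without square
  roots.\<close>

definition arc_ratio_deriv :: "real \<Rightarrow> real" where
  "arc_ratio_deriv x = (x * arc_ratio x - 1) / (1 - x\<^sup>2)"

lemma has_real_derivative_arc_ratio:
  assumes "\<bar>x\<bar> < 1"
  shows "(arc_ratio has_real_derivative arc_ratio_deriv x) (at x)"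
proof -
  define r where "r = sqrt (1 - x\<^sup>2)"
  have r: "0 < r" "1 - x\<^sup>2 = r\<^sup>2" "1 - x\<^sup>2 > 0"
    using one_minus_square_pos[OF assms] by (auto simp: r_def)
  have "((\<lambda>x. sqrt (1 - x\<^sup>2)) has_real_derivative (inverse r / 2) * (0 - 2 * x)) (at x)"
    unfolding r_def using r(3)
    by (intro DERIV_chain2[OF DERIV_real_sqrt]) (auto intro!: derivative_eq_intros)
  from DERIV_divide[OF DERIV_arccos this]
  have "((\<lambda>x. arccos x / sqrt (1 - x\<^sup>2)) has_real_derivative
      (inverse (- r) * r - arccos x * ((inverse r / 2) * (0 - 2 * x))) / (r * r)) (at x)"
    using assms r by (simp add: abs_less_iff flip: r_def)
  moreover have "(inverse (- r) * r - arccos x * ((inverse r / 2) * (0 - 2 * x))) / (r * r)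
      = arc_ratio_deriv x"
    unfolding arc_ratio_deriv_def arc_ratio_def r_def[symmetric] r(2)
    using r(1) by (simp add: field_simps power2_eq_square)
  ultimately show ?thesis
    unfolding arc_ratio_def by simp
qed

lemma arc_ratio_deriv_ode: "\<bar>x\<bar> < 1 \<Longrightarrow> (1 - x\<^sup>2) * arc_ratio_deriv x = x * arc_ratio x - 1"
  using one_minus_square_pos[of x] by (simp add: arc_ratio_deriv_def)

lemma arc_ratio_deriv_neg: "\<bar>x\<bar> < 1 \<Longrightarrow> arc_ratio_deriv x < 0"
  using one_minus_square_pos[of x] mult_arc_ratio_less_1[of x]
  by (simp add: arc_ratio_deriv_def divide_neg_pos)

text \<open>The geodesic with parameter c reaches, at time t, the point with upper left entry
  z exp (- i c t / 2) where z = cos u + i m sin u, u = sqrt (1 + c^2) t / 2 and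
  m = c / sqrt (1 + c^2). As u / sin u = \<open>arc_ratio\<close> (Re z), both c t / 2 = m u and t are
  functions of z, and z ranges over the whole open unit disc.\<close>

definition chart :: "complex \<Rightarrow> complex" where
  "chart z = z * cis (- (Im z * arc_ratio (Re z)))"

definition chart_time :: "complex \<Rightarrow> real" where
  "chart_time z = 2 * sqrt (1 - (cmod z)\<^sup>2) * arc_ratio (Re z)"

text \<open>The derivative at \<open>z\<close>, in the direction \<open>v\<close>, of the rotation
  angle \<open>Im z * arc_ratio (Re z)\<close> of \<open>chart\<close>.\<close>

definition chart_twist :: "complex \<Rightarrow> complex \<Rightarrow> real" where
  "chart_twist z v = Im v * arc_ratio (Re z) + Im z * (arc_ratio_deriv (Re z) * Re v)"

definition chart_deriv :: "complex \<Rightarrow> complex \<Rightarrow> complex" where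
  "chart_deriv z v =
     cis (- (Im z * arc_ratio (Re z))) * (v - \<i> * z * of_real (chart_twist z v))"

lemma cmod_chart [simp]: "cmod (chart z) = cmod z"
  by (simp add: chart_def norm_mult)

lemma abs_Re_less: "cmod z < 1 \<Longrightarrow> \<bar>Re z\<bar> < 1"
  using abs_Re_le_cmod[of z] by linarith

section \<open>Differential of the chart and the eikonal equation\<close>

lemma has_derivative_arc_ratio_Re:
  assumes "cmod z < 1"
  shows "((\<lambda>z. arc_ratio (Re z)) has_derivative (\<lambda>v. arc_ratio_deriv (Re z) * Re v)) (at z)"
  using DERIV_compose_FDERIV[OF has_real_derivative_arc_ratio[OF abs_Re_less[OF assms]]
      has_derivative_Re[OF has_derivative_ident]]
  by (simp add: mult.commute)

lemma has_derivative_chart: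
  assumes "cmod z < 1"
  shows "(chart has_derivative chart_deriv z) (at z)"
  unfolding chart_def
  by (rule has_derivative_eq_rhs, (rule derivative_intros has_derivative_arc_ratio_Re assms)+)
    (auto simp: chart_deriv_def chart_twist_def fun_eq_iff scaleR_conv_of_real algebra_simps)

text \<open>The direction \<open>\<i> * z\<close> is tangent to the circle through \<open>z\<close>.
  The differential equation of \<open>arc_ratio\<close> trades
  \<open>Re z * arc_ratio (Re z)\<close> for 1 plus a multiple of the derivative, which leaves the
  factor 1 - |z|^2.\<close>

lemma chart_twist_radial:
  assumes "cmod z < 1"
  shows "chart_twist z (\<i> * z) = 1 + (1 - (cmod z)\<^sup>2) * arc_ratio_deriv (Re z)"
  using arc_ratio_deriv_ode[OF abs_Re_less[OF assms]]
  unfolding chart_twist_def cmod_power2 by (simp add: algebra_simps power2_eq_square)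

lemma chart_twist_radial_less_1:
  assumes "cmod z < 1"
  shows "chart_twist z (\<i> * z) < 1"
  unfolding chart_twist_radial[OF assms]
  using arc_ratio_deriv_neg[OF abs_Re_less[OF assms]] one_minus_square_pos[of "cmod z"] assms
  by (simp add: mult_pos_neg)

lemma linear_chart_deriv: "linear (chart_deriv z)"
  by (rule linearI) (auto simp: chart_deriv_def chart_twist_def algebra_simps scaleR_conv_of_real)

text \<open>A kernel vector is k times \<open>\<i> * z\<close>, where k is its own twist. Hence k
  equals k times the twist of \<open>\<i> * z\<close>, which is less than 1, so k = 0.\<close>

lemma inj_chart_deriv:
  assumes "cmod z < 1"
  shows "inj (chart_deriv z)"
  unfolding linear_injective_0[OF linear_chart_deriv]
proof (intro allI impI)
  fix v assume "chart_deriv z v = 0"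
  then have v: "v = of_real (chart_twist z v) * (\<i> * z)"
    by (simp add: chart_deriv_def algebra_simps)
  have "chart_twist z (of_real k * w) = k * chart_twist z w" for k w
    by (simp add: chart_twist_def algebra_simps)
  then have "chart_twist z v = chart_twist z v * chart_twist z (\<i> * z)"
    using v by metis
  then show "v = 0"
    using chart_twist_radial_less_1[OF assms] v by auto
qed

text \<open>The eikonal equation: the differential of the time is the pairing with a vector of norm
  2 / sqrt (1 - (cmod z)^2), transported by the differential of the chart.\<close>

lemma has_derivative_chart_time:
  assumes "cmod z < 1"
  shows "(chart_time has_derivative
    (\<lambda>v. - (2 / sqrt (1 - (cmod z)\<^sup>2)) * Re (cis (Im z * arc_ratio (Re z)) * chart_deriv z v))) (at z)"
proof -
  define b where "b = sqrt (1 - (cmod z)\<^sup>2)"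
  have b: "0 < b" "b\<^sup>2 = 1 - (Re z)\<^sup>2 - (Im z)\<^sup>2"
    "b = sqrt (1 - ((Re z)\<^sup>2 + (Im z)\<^sup>2))" "0 < 1 - ((Re z)\<^sup>2 + (Im z)\<^sup>2)"
    using one_minus_square_pos[of "cmod z"] assms by (auto simp: b_def cmod_power2 algebra_simps)
  let ?G = "arc_ratio (Re z)" and ?G' = "arc_ratio_deriv (Re z)"
  have "((\<lambda>z. 1 - ((Re z)\<^sup>2 + (Im z)\<^sup>2)) has_derivative
    (\<lambda>v. - (2 * (Re z * Re v + Im z * Im v)))) (at z)"
    by (auto intro!: derivative_eq_intros simp: algebra_simps)
  from DERIV_compose_FDERIV[OF DERIV_real_sqrt[OF b(4)] this]
  have "((\<lambda>z. sqrt (1 - ((Re z)\<^sup>2 + (Im z)\<^sup>2))) has_derivative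
    (\<lambda>v. - (Re z * Re v + Im z * Im v) / b)) (at z)"
    unfolding b(3)[symmetric]
    by (rule has_derivative_eq_rhs) (use b(1) in \<open>simp add: fun_eq_iff field_simps\<close>)
  from has_derivative_mult[OF has_derivative_mult_right[OF this] has_derivative_arc_ratio_Re[OF assms], of 2]
  have "((\<lambda>z. 2 * sqrt (1 - ((Re z)\<^sup>2 + (Im z)\<^sup>2)) * arc_ratio (Re z)) has_derivative
    (\<lambda>v. 2 * b * (?G' * Re v) - 2 * (Re z * Re v + Im z * Im v) / b * ?G)) (at z)"
    unfolding b(3)[symmetric]
    by (rule has_derivative_eq_rhs) (simp add: fun_eq_iff algebra_simps add_divide_distrib diff_divide_distrib)
  moreover have "2 * b * (?G' * Re v) - 2 * (Re z * Re v + Im z * Im v) / b * ?G =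
     - (2 / b) * Re (cis (Im z * ?G) * chart_deriv z v)" for v
  proof -
    have "Re (cis (Im z * ?G) * chart_deriv z v) = Re (v - \<i> * z * of_real (chart_twist z v))"
      unfolding chart_deriv_def mult.assoc[symmetric] cis_mult by simp
    also have "\<dots> = Re v + Im z * chart_twist z v"
      by simp
    also have "\<dots> = (Re z * Re v + Im z * Im v) * ?G - b\<^sup>2 * (?G' * Re v)"
    proof -
      \<comment> \<open>The differential equation eliminates the isolated \<open>Re v\<close>, so
        that every remaining term carries \<open>arc_ratio\<close> or its derivative.\<close>
      have "Re v * ((1 - (Re z)\<^sup>2) * ?G') = Re v * (Re z * ?G - 1)"
        using arc_ratio_deriv_ode[OF abs_Re_less[OF assms]] by simp
      then show ?thesis
        unfolding b(2) chart_twist_def by (simp add: algebra_simps power2_eq_square)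
    qed
    finally have *: "Re (cis (Im z * ?G) * chart_deriv z v) =
      (Re z * Re v + Im z * Im v) * ?G - b\<^sup>2 * (?G' * Re v)" .
    show ?thesis
      unfolding * using b(1) by (simp add: field_simps power2_eq_square)
  qed
  ultimately show ?thesis
    unfolding chart_time_def b_def[symmetric] unfolding cmod_power2 by simp
qed

section \<open>The chart as a bijection of the open disc\<close>

definition chart_angle :: "real \<Rightarrow> real \<Rightarrow> real" where
  "chart_angle r \<phi> = \<phi> - r * sin \<phi> * arc_ratio (r * cos \<phi>)"

lemma chart_rcis: "chart (rcis r \<phi>) = rcis r (chart_angle r \<phi>)"
  by (simp add: chart_def chart_angle_def rcis_def cis_mult mult.assoc)

lemma abs_mult_cos_less_1:
  fixes r :: real
  assumes "0 \<le> r" "r < 1"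
  shows "\<bar>r * cos \<phi>\<bar> < 1"
  using mult_left_mono[OF abs_cos_le_one[of \<phi>] assms(1)] assms by (simp add: abs_mult)

text \<open>The derivative is 1 minus the twist of \<open>\<i> * z\<close> at
  \<open>z = rcis r \<phi>\<close>; the cancellation is that of
  \<open>chart_twist_radial\<close>.\<close>

lemma has_real_derivative_chart_angle:
  assumes "0 \<le> r" "r < 1"
  shows "(chart_angle r has_real_derivative (r\<^sup>2 - 1) * arc_ratio_deriv (r * cos \<phi>)) (at \<phi>)"
proof -
  note x = abs_mult_cos_less_1[OF assms, of \<phi>]
  have "((\<lambda>\<phi>. arc_ratio (r * cos \<phi>)) has_real_derivative
    arc_ratio_deriv (r * cos \<phi>) * (- (r * sin \<phi>))) (at \<phi>)"
    by (rule DERIV_chain2[where f = arc_ratio and g = "\<lambda>\<phi>. r * cos \<phi>"])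
      (auto intro!: derivative_eq_intros has_real_derivative_arc_ratio x)
  then have "(chart_angle r has_real_derivative
    1 - (r * sin \<phi> * (arc_ratio_deriv (r * cos \<phi>) * (- (r * sin \<phi>)))
       + r * cos \<phi> * arc_ratio (r * cos \<phi>))) (at \<phi>)"
    unfolding chart_angle_def by (auto intro!: derivative_eq_intros)
  moreover have "1 - (r * sin \<phi> * (arc_ratio_deriv (r * cos \<phi>) * (- (r * sin \<phi>)))
       + r * cos \<phi> * arc_ratio (r * cos \<phi>)) = (r\<^sup>2 - 1) * arc_ratio_deriv (r * cos \<phi>)"
  proof -
    have s: "sin \<phi> * sin \<phi> = 1 - cos \<phi> * cos \<phi>"
      using sin_squared_eq[of \<phi>] by (simp add: power2_eq_square)
    have "r * r * (sin \<phi> * sin \<phi>) * d = r * r * d - r * r * (cos \<phi> * cos \<phi>) * d" for d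
      unfolding s by (simp add: algebra_simps)
    from this[of "arc_ratio_deriv (r * cos \<phi>)"] show ?thesis
      using arc_ratio_deriv_ode[OF x] by (simp add: power2_eq_square algebra_simps)
  qed
  ultimately show ?thesis by simp
qed

lemma strict_mono_chart_angle:
  assumes "0 \<le> r" "r < 1" "\<phi> < \<phi>'"
  shows "chart_angle r \<phi> < chart_angle r \<phi>'"
proof (rule DERIV_pos_imp_increasing[OF assms(3)], intro exI conjI)
  fix \<eta>
  show "(chart_angle r has_real_derivative (r\<^sup>2 - 1) * arc_ratio_deriv (r * cos \<eta>)) (at \<eta>)"
    by (rule has_real_derivative_chart_angle[OF assms(1,2)])
  show "0 < (r\<^sup>2 - 1) * arc_ratio_deriv (r * cos \<eta>)"
    using arc_ratio_deriv_neg[OF abs_mult_cos_less_1[OF assms(1,2)]] one_minus_square_pos[of r] assms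
    by (intro mult_neg_neg) auto
qed

lemma chart_angle_less_iff:
  "0 \<le> r \<Longrightarrow> r < 1 \<Longrightarrow> chart_angle r \<phi> < chart_angle r \<phi>' \<longleftrightarrow> \<phi> < \<phi>'"
  by (metis strict_mono_chart_angle less_asym linorder_neqE_linordered_idom order_less_irrefl)

lemma chart_angle_0 [simp]: "chart_angle r 0 = 0"
  and chart_angle_2pi [simp]: "chart_angle r (2 * pi) = 2 * pi"
  by (simp_all add: chart_angle_def)

lemma chart_angle_surj:
  assumes "0 \<le> r" "r < 1" "0 \<le> \<theta>" "\<theta> \<le> 2 * pi"
  obtains \<phi> where "0 \<le> \<phi>" "\<phi> \<le> 2 * pi" "chart_angle r \<phi> = \<theta>"
proof -
  have "isCont (chart_angle r) \<phi>" for \<phi>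
    using has_real_derivative_chart_angle[OF assms(1,2)] by (rule DERIV_isCont)
  then have "\<exists>\<phi>\<ge>0. \<phi> \<le> 2 * pi \<and> chart_angle r \<phi> = \<theta>"
    using assms by (intro IVT) auto
  then show ?thesis using that by blast
qed

lemma is_Arg_iff_rcis: "is_Arg z \<theta> \<longleftrightarrow> z = rcis (cmod z) \<theta>"
  by (simp add: is_Arg_def rcis_def cis_conv_exp)

text \<open>As \<open>chart\<close> preserves moduli, it suffices to look at each circle, where it
  acts on angles as the increasing map \<open>chart_angle\<close> with fixed points 0 and 2 pi. For
  injectivity the centre, which has no definite angle, is treated apart.\<close>

lemma bij_betw_chart: "bij_betw chart (ball 0 1) (ball 0 1)"
  unfolding bij_betw_def
proof
  show "inj_on chart (ball 0 1)"
  proof (rule inj_onI)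
    fix z w assume zw: "z \<in> ball 0 1" "w \<in> ball 0 1" "chart z = chart w"
    then have r: "cmod w = cmod z" by (metis cmod_chart)
    show "z = w"
    proof (cases "z = 0")
      case False
      define a where "a = chart_angle (cmod z) (Arg2pi z)"
      define b where "b = chart_angle (cmod z) (Arg2pi w)"
      have z: "z = rcis (cmod z) (Arg2pi z)" and w: "w = rcis (cmod z) (Arg2pi w)"
        using Arg2pi[of z] Arg2pi[of w] r by (auto simp: is_Arg_iff_rcis)
      have bounds: "0 \<le> a" "a < 2 * pi" "0 \<le> b" "b < 2 * pi"
        using Arg2pi[of z] Arg2pi[of w] zw(1)
          chart_angle_less_iff[of "cmod z" "Arg2pi z" 0] chart_angle_less_iff[of "cmod z" "Arg2pi w" 0]
          chart_angle_less_iff[of "cmod z" "Arg2pi z" "2*pi"] chart_angle_less_iff[of "cmod z" "Arg2pi w" "2*pi"]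
        unfolding a_def b_def by auto
      have "is_Arg (chart z) a" "is_Arg (chart z) b"
        using z w zw(3) chart_rcis r unfolding a_def b_def is_Arg_iff_rcis cmod_chart by metis+
      then have "a = b"
        by (rule is_Arg_eqI) (use bounds False in \<open>auto simp: chart_def\<close>)
      then have "Arg2pi z = Arg2pi w"
        using chart_angle_less_iff[of "cmod z" "Arg2pi z" "Arg2pi w"] zw(1)
          chart_angle_less_iff[of "cmod z" "Arg2pi w" "Arg2pi z"]
        unfolding a_def b_def by fastforce
      then show ?thesis using z w by metis
    qed (use r in auto)
  qed
  have "w \<in> chart ` ball 0 1" if "w \<in> ball 0 1" for w
  proof -
    obtain \<phi> where "chart_angle (cmod w) \<phi> = Arg2pi w"
      using chart_angle_surj[of "cmod w" "Arg2pi w"] Arg2pi[of w] \<open>w \<in> ball 0 1\<close> by auto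
    then have "w = chart (rcis (cmod w) \<phi>)"
      using Arg2pi[of w] by (simp add: chart_rcis is_Arg_iff_rcis)
    then show ?thesis
      using \<open>w \<in> ball 0 1\<close> by (intro image_eqI[of _ _ "rcis (cmod w) \<phi>"]) auto
  qed
  then show "chart ` ball 0 1 = ball 0 1" by auto
qed

definition unchart :: "complex \<Rightarrow> complex" where
  "unchart = inv_into (ball 0 1) chart"

lemma chart_unchart: "cmod w < 1 \<Longrightarrow> chart (unchart w) = w"
  using bij_betw_chart unfolding unchart_def by (simp add: bij_betw_inv_into_right)

lemma unchart_chart: "cmod z < 1 \<Longrightarrow> unchart (chart z) = z"
  using bij_betw_chart unfolding unchart_def by (simp add: bij_betw_inv_into_left)

lemma cmod_unchart: "cmod w < 1 \<Longrightarrow> cmod (unchart w) = cmod w"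
  by (metis chart_unchart cmod_chart)

lemma continuous_unchart:
  assumes "cmod w < 1"
  shows "continuous (at w) unchart"
proof -
  \<comment> \<open>Compactness makes the inverse of a continuous injection continuous, hence the
    passage to a closed disc of radius strictly between |w| and 1.\<close>
  obtain r where r: "cmod w < r" "r < 1" using assms dense by blast
  have "continuous_on (chart ` cball 0 r) unchart"
  proof (rule continuous_on_inv)
    show "continuous_on (cball 0 r) chart"
      using r has_derivative_continuous[OF has_derivative_chart]
      by (intro continuous_at_imp_continuous_on) auto
  qed (use r unchart_chart in auto)
  moreover have "cball 0 r \<subseteq> chart ` cball 0 r"
  proof
    fix y :: complex assume "y \<in> cball 0 r"
    then show "y \<in> chart ` cball 0 r"
      using r chart_unchart[of y] cmod_unchart[of y] by (intro image_eqI[of _ _ "unchart y"]) auto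
  qed
  ultimately have "continuous_on (cball 0 r) unchart"
    by (rule continuous_on_subset)
  then show ?thesis
    using r by (intro continuous_on_interior) auto
qed

section \<open>The time of arrival as a function on the disc\<close>

text \<open>Meaningful for |w| < 1; the distances belonging to points of the boundary circle appear
  as radial limits.\<close>

definition disc_dist :: "complex \<Rightarrow> real" where
  "disc_dist w = chart_time (unchart w)"

lemma has_derivative_disc_dist:
  assumes "cmod w < 1"
  obtains e where "cmod e = 1"
    "(disc_dist has_derivative (\<lambda>v. - (2 / sqrt (1 - (cmod w)\<^sup>2)) * Re (e * v))) (at w)"
proof -
  let ?z = "unchart w"
  have z: "cmod ?z < 1" "cmod ?z = cmod w" "chart ?z = w"
    using assms by (auto simp: cmod_unchart chart_unchart)
  obtain g where g: "linear g" "g \<circ> chart_deriv ?z = id"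
    using linear_injective_left_inverse[OF linear_chart_deriv inj_chart_deriv[OF z(1)]] by blast
  \<comment> \<open>In finite dimension the left inverse is also a right inverse. With it the factor
    \<open>chart_deriv\<close> in the derivative of \<open>chart_time\<close> cancels, leaving
    multiplication by a unit complex number.\<close>
  then have g': "chart_deriv ?z (g v) = v" for v
    using linear_inverse_left[OF linear_chart_deriv g(1)] by (metis comp_apply id_apply)
  have "(unchart has_derivative g) (at w)"
  proof (rule has_derivative_inverse_basic[where f = chart and T = "ball 0 1"])
    show "(chart has_derivative chart_deriv ?z) (at ?z)" by (rule has_derivative_chart[OF z(1)])
    show "bounded_linear g" using g(1) by (simp add: linear_conv_bounded_linear)
  qed (use g assms continuous_unchart chart_unchart in auto)
  from has_derivative_compose[OF this has_derivative_chart_time[OF z(1)]]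
  have "(disc_dist has_derivative
    (\<lambda>v. - (2 / sqrt (1 - (cmod w)\<^sup>2)) * Re (cis (Im ?z * arc_ratio (Re ?z)) * v))) (at w)"
    unfolding g' z(2) disc_dist_def by simp
  then show ?thesis
    by (rule that[rotated]) simp
qed

section \<open>The system and its unique solution\<close>

text \<open>The upper left entry of exp (t (A + c k)), where A is any unit vector of the span of
  \<open>p1\<close> and \<open>p2\<close>, and k generates the diagonal subgroup.\<close>

definition geodesic_point :: "real \<Rightarrow> real \<Rightarrow> complex" where
  "geodesic_point c t = (let s = sqrt (1 + c\<^sup>2) in Complex (cos (s * t / 2)) (c / s * sin (s * t / 2)))"

lemma geodesic_point_facts:
  assumes "t \<in> {0<..<2 * pi / sqrt (1 + c\<^sup>2)}"
  defines "z \<equiv> geodesic_point c t"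
  shows "sqrt (1 - (cmod z)\<^sup>2) = sin (sqrt (1 + c\<^sup>2) * t / 2) / sqrt (1 + c\<^sup>2)"
    and "cmod z < 1" and "chart_time z = t" and "c = Im z / sqrt (1 - (cmod z)\<^sup>2)"
    and "Im z * arc_ratio (Re z) = c * t / 2"
proof -
  define s where "s = sqrt (1 + c\<^sup>2)"
  define u where "u = s * t / 2"
  have s: "0 < s" "s\<^sup>2 = 1 + c\<^sup>2" "t = 2 * u / s"
    using add_pos_nonneg[OF zero_less_one zero_le_power2[of c]] by (auto simp: s_def u_def)
  have u: "0 < u" "u < pi" "0 < sin u"
    using assms(1) s(1) sin_gt_zero[of u] by (auto simp: u_def field_simps simp flip: s_def)
  have z: "Re z = cos u" "Im z = c / s * sin u"
    by (simp_all add: z_def geodesic_point_def s_def u_def Let_def)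
  have "(cmod z)\<^sup>2 = 1 - (sin u / s)\<^sup>2"
  proof -
    have "s\<^sup>2 * (cos u)\<^sup>2 + c\<^sup>2 * (sin u)\<^sup>2 = s\<^sup>2 - (sin u)\<^sup>2"
      unfolding s(2) cos_squared_eq by (simp add: algebra_simps)
    then show ?thesis
      using s(1) unfolding cmod_power2 z by (simp add: field_simps power_mult_distrib power_divide)
  qed
  then have b: "sqrt (1 - (cmod z)\<^sup>2) = sin u / s" "(cmod z)\<^sup>2 < 1"
    using u s(1) by (simp_all add: divide_nonneg_pos)
  then show "sqrt (1 - (cmod z)\<^sup>2) = sin (sqrt (1 + c\<^sup>2) * t / 2) / sqrt (1 + c\<^sup>2)"
    by (simp add: u_def s_def)
  show "cmod z < 1"
    using b(2) by (simp add: abs_square_less_1)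
  show "chart_time z = t"
    unfolding chart_time_def b z arc_ratio_cos[OF u(1,2)] s(3) using u s(1) by simp
  show "c = Im z / sqrt (1 - (cmod z)\<^sup>2)"
    unfolding b z using u s(1) by simp
  show "Im z * arc_ratio (Re z) = c * t / 2"
    unfolding z arc_ratio_cos[OF u(1,2)] s(3) using u s(1) by simp
qed

lemma geodesic_point_surj:
  assumes "cmod z < 1"
  obtains c t where "t \<in> {0<..<2 * pi / sqrt (1 + c\<^sup>2)}" "geodesic_point c t = z"
proof -
  define b where "b = sqrt (1 - (cmod z)\<^sup>2)"
  define c where "c = Im z / b"
  define r where "r = sqrt (1 - (Re z)\<^sup>2)"
  define u where "u = arccos (Re z)"
  have b: "0 < b" "b\<^sup>2 = 1 - (cmod z)\<^sup>2"
    using one_minus_square_pos[of "cmod z"] assms by (auto simp: b_def)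
  have x: "\<bar>Re z\<bar> < 1" using assms by (rule abs_Re_less)
  have r: "0 < r" "r = sin u"
    using one_minus_square_pos[OF x] x by (auto simp: r_def u_def sin_arccos_abs)
  have u: "0 < u" "u < pi" "cos u = Re z"
    using x arccos_lt_bounded[of "Re z"] by (auto simp: u_def abs_less_iff)
  have "r\<^sup>2 = b\<^sup>2 + (Im z)\<^sup>2"
    using one_minus_square_pos[OF x] by (simp add: r_def b(2) cmod_power2)
  then have "1 + c\<^sup>2 = (r / b)\<^sup>2"
    using b(1) by (simp add: c_def power_divide field_simps)
  then have s: "sqrt (1 + c\<^sup>2) = r / b"
    using b(1) r(1) by simp
  show ?thesis
  proof (rule that)
    \<comment> \<open>This is the time 2 u / sqrt (1 + c^2), since the choice c = Im z / b gives 1 +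
      c^2 = (r / b)^2.\<close>
    show "2 * u * b / r \<in> {0<..<2 * pi / sqrt (1 + c\<^sup>2)}"
      unfolding s using u r(1) b(1) by (simp add: field_simps)
    have "r / b * (2 * u * b / r) / 2 = u"
      using r(1) b(1) by simp
    then show "geodesic_point c (2 * u * b / r) = z"
      using b(1) r unfolding geodesic_point_def s Let_def by (simp add: complex_eq_iff u c_def)
  qed
qed

text \<open>The range of \<open>t\<close> puts u = sqrt (1 + c^2) t / 2 in (0, pi), where the arctan
  branch is the argument of \<open>geodesic_point c t\<close>. The first equation then matches the
  angle of \<open>chart (geodesic_point c t)\<close> with that of \<open>\<alpha>\<close>, and the
  second matches the moduli.\<close>

lemma psi_system_iff:
  assumes "cmod \<alpha> < 1"
  shows "psi_system \<alpha> c t \<longleftrightarrow>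
    t \<in> {0<..<2 * pi / sqrt (1 + c\<^sup>2)} \<and> chart (geodesic_point c t) = \<alpha>"
proof (cases "t \<in> {0<..<2 * pi / sqrt (1 + c\<^sup>2)}")
  case t: True
  define z where "z = geodesic_point c t"
  define u where "u = sqrt (1 + c\<^sup>2) * t / 2"
  note facts = geodesic_point_facts[OF t, folded z_def]
  have s: "0 < sqrt (1 + c\<^sup>2)"
    using add_pos_nonneg[OF zero_less_one zero_le_power2[of c]] by simp
  then have u: "0 < u" "u < pi"
    using t by (auto simp: u_def field_simps)
  have "arctan_branch (c / sqrt (1 + c\<^sup>2)) u = Arg z"
    using arctan_branch_eq_Arg[OF u] by (simp add: z_def geodesic_point_def u_def Let_def)
  then have angle: "- (c * t / 2) + arctan_branch (c / sqrt (1 + c\<^sup>2)) (sqrt (1 + c\<^sup>2) * t / 2)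
      = Arg z - Im z * arc_ratio (Re z)"
    by (simp add: u_def facts(5))
  have chart: "chart z = rcis (cmod z) (Arg z - Im z * arc_ratio (Re z))"
  proof -
    have "rcis (cmod z) (Arg z - Im z * arc_ratio (Re z))
      = rcis (cmod z) (Arg z) * cis (- (Im z * arc_ratio (Re z)))"
      by (simp add: rcis_def cis_mult mult.assoc)
    then show ?thesis by (simp add: chart_def rcis_cmod_Arg)
  qed
  have "sqrt (1 - (cmod z)\<^sup>2) = sqrt (1 - (cmod \<alpha>)\<^sup>2) \<longleftrightarrow> cmod z = cmod \<alpha>"
    by simp
  then have "psi_system \<alpha> c t \<longleftrightarrow>
     is_Arg \<alpha> (Arg z - Im z * arc_ratio (Re z)) \<and> cmod z = cmod \<alpha>"
    unfolding psi_system_def angle facts(1)[symmetric] using t by simp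
  also have "\<dots> \<longleftrightarrow> chart z = \<alpha>"
    unfolding is_Arg_iff_rcis chart by (metis chart cmod_chart)
  finally show ?thesis using t by (simp add: z_def)
qed (auto simp: psi_system_def)

lemma psi_system_unique:
  assumes "cmod \<alpha> < 1"
  shows "\<exists>!p. psi_system \<alpha> (fst p) (snd p)" and "psi \<alpha> = disc_dist \<alpha>"
proof -
  define z where "z = unchart \<alpha>"
  have z: "cmod z < 1" "chart z = \<alpha>"
    using assms by (simp_all add: z_def cmod_unchart chart_unchart)
  obtain c0 t0 where 0: "t0 \<in> {0<..<2 * pi / sqrt (1 + c0\<^sup>2)}" "geodesic_point c0 t0 = z"
    using geodesic_point_surj[OF z(1)] by blast
  have system: "psi_system \<alpha> c0 t0"
    using psi_system_iff[OF assms] 0 z by simp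
  have uniq: "c = Im z / sqrt (1 - (cmod z)\<^sup>2)" "t = chart_time z" if "psi_system \<alpha> c t" for c t
  proof -
    have t: "t \<in> {0<..<2 * pi / sqrt (1 + c\<^sup>2)}" "chart (geodesic_point c t) = \<alpha>"
      using that psi_system_iff[OF assms] by auto
    have "geodesic_point c t = z"
      using unchart_chart[OF geodesic_point_facts(2)[OF t(1)]] t(2) by (simp add: z_def)
    then show "c = Im z / sqrt (1 - (cmod z)\<^sup>2)" "t = chart_time z"
      using geodesic_point_facts(3,4)[OF t(1)] by simp_all
  qed
  show "\<exists>!p. psi_system \<alpha> (fst p) (snd p)"
  proof (rule ex1I)
    show "psi_system \<alpha> (fst (c0, t0)) (snd (c0, t0))"
      using system by simp
    show "p = (c0, t0)" if "psi_system \<alpha> (fst p) (snd p)" for p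
      unfolding prod_eq_iff fst_conv snd_conv using uniq[OF that] uniq[OF system] by metis
  qed
  have "psi \<alpha> = t0"
    unfolding psi_def by (rule the_equality) (use system uniq(2) in metis)+
  then show "psi \<alpha> = disc_dist \<alpha>"
    using uniq(2)[OF system] by (simp add: disc_dist_def z_def)
qed

section \<open>Radial limits of the time of arrival\<close>

lemma disc_dist_of_real:
  assumes "0 \<le> r" "r < 1"
  shows "disc_dist (of_real r) = 2 * arccos r"
proof -
  have "chart (of_real r) = of_real r"
    by (simp add: chart_def)
  then have "disc_dist (of_real r) = chart_time (of_real r)"
    using unchart_chart[of "of_real r"] assms by (simp add: disc_dist_def)
  also have "\<dots> = 2 * arccos r"
    using one_minus_square_pos[of r] assms by (simp add: chart_time_def arc_ratio_def)
  finally show ?thesis .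
qed

lemma tendsto_arccos:
  assumes "(f \<longlongrightarrow> l) F" "\<bar>l\<bar> \<le> 1" "\<forall>\<^sub>F x in F. \<bar>f x\<bar> \<le> 1"
  shows "((\<lambda>x. arccos (f x)) \<longlongrightarrow> arccos l) F"
  by (rule continuous_on_tendsto_compose[OF continuous_on_arccos' assms(1)])
    (use assms in \<open>auto simp: abs_le_iff elim!: eventually_mono\<close>)

lemma eventually_at_left_1: "\<forall>\<^sub>F r in at_left (1::real). 0 \<le> r \<and> r < 1"
  using eventually_at_left_field[of _ "1::real"] by (auto intro: exI[of _ 0])

text \<open>A contracted curve ends at r and not at 1; this limit makes the mismatch
  disappear.\<close>

lemma tendsto_disc_dist_1: "((\<lambda>r. disc_dist (of_real r)) \<longlongrightarrow> 0) (at_left 1)"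
proof -
  have "((\<lambda>r::real. arccos r) \<longlongrightarrow> arccos 1) (at_left 1)"
    using eventually_at_left_1 by (intro tendsto_arccos tendsto_ident_at) (auto elim!: eventually_mono)
  then have "((\<lambda>r::real. 2 * arccos r) \<longlongrightarrow> 2 * 0) (at_left 1)"
    by (intro tendsto_mult tendsto_const) simp
  then show ?thesis
    by (rule Lim_transform_eventually[THEN tendsto_eq_rhs])
      (use eventually_at_left_1 disc_dist_of_real in \<open>auto elim!: eventually_mono\<close>)
qed

text \<open>In the limit, sin phi times \<open>arc_ratio (cos \<phi>)\<close> is phi on (0, pi) and
  phi - 2 pi on (pi, 2 pi): each open half of the circle collapses to the point 1, so the other
  angles are reached only near phi = pi.\<close>

lemma chart_angle_tendsto:
  assumes "0 < \<phi>" "\<phi> < pi \<or> (pi < \<phi> \<and> \<phi> < 2 * pi)"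
  shows "((\<lambda>r. chart_angle r \<phi>) \<longlongrightarrow> (if \<phi> < pi then 0 else 2 * pi)) (at_left 1)"
proof -
  have s: "sin \<phi> \<noteq> 0"
    using assms sin_gt_zero[of \<phi>] sin_lt_zero[of \<phi>] by auto
  have c: "\<bar>cos \<phi>\<bar> < 1"
    using s sin_cos_squared_add[of \<phi>] zero_less_power2[of "sin \<phi>"]
    unfolding abs_square_less_1[symmetric] by linarith
  have "isCont arc_ratio (cos \<phi>)"
    by (rule DERIV_isCont[OF has_real_derivative_arc_ratio[OF c]])
  then have "((\<lambda>r. arc_ratio (r * cos \<phi>)) \<longlongrightarrow> arc_ratio (cos \<phi>)) (at_left 1)"
    by (rule isCont_tendsto_compose) (auto intro!: tendsto_eq_intros)
  then have "((\<lambda>r. chart_angle r \<phi>) \<longlongrightarrow> \<phi> - 1 * sin \<phi> * arc_ratio (cos \<phi>)) (at_left 1)"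
    unfolding chart_angle_def by (intro tendsto_intros)
  moreover have "\<phi> - 1 * sin \<phi> * arc_ratio (cos \<phi>) = (if \<phi> < pi then 0 else 2 * pi)"
  proof (cases "\<phi> < pi")
    case True
    then show ?thesis using arc_ratio_cos[of \<phi>] assms s by simp
  next
    case False
    have "cos (2 * pi - \<phi>) = cos \<phi>" "sin (2 * pi - \<phi>) = - sin \<phi>"
      by (simp_all add: cos_diff sin_diff)
    then show ?thesis using arc_ratio_cos[of "2 * pi - \<phi>"] assms s False by (simp add: field_simps)
  qed
  ultimately show ?thesis by simp
qed

text \<open>At the boundary \<open>chart_time\<close> takes the indeterminate form 0 times infinity
  when phi tends to pi. Here every ingredient converges instead.\<close>

lemma disc_dist_rcis:
  assumes "0 \<le> r" "r < 1" "chart_angle r \<phi> = \<theta>"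
  shows "disc_dist (rcis r \<theta>) = 2 * sqrt ((arccos (r * cos \<phi>))\<^sup>2 - (\<phi> - \<theta>)\<^sup>2)"
proof -
  let ?x = "r * cos \<phi>" and ?y = "r * sin \<phi>"
  note x = abs_mult_cos_less_1[OF assms(1,2), of \<phi>]
  note pos = one_minus_square_pos[OF x]
  have u: "arccos ?x = sqrt (1 - ?x\<^sup>2) * arc_ratio ?x"
    using pos by (simp add: arc_ratio_def)
  have d: "\<phi> - \<theta> = ?y * arc_ratio ?x"
    using assms(3) by (simp add: chart_angle_def)
  have r: "r\<^sup>2 = ?x\<^sup>2 + ?y\<^sup>2"
    by (simp add: power_mult_distrib flip: distrib_left)
  have "(arccos ?x)\<^sup>2 - (\<phi> - \<theta>)\<^sup>2 = (1 - ?x\<^sup>2) * (arc_ratio ?x)\<^sup>2 - ?y\<^sup>2 * (arc_ratio ?x)\<^sup>2"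
    unfolding u d power_mult_distrib[of "sqrt _"] power_mult_distrib[of ?y] using pos by simp
  also have "\<dots> = (1 - r\<^sup>2) * (arc_ratio ?x)\<^sup>2"
    unfolding r by (simp add: algebra_simps)
  finally have "sqrt ((arccos ?x)\<^sup>2 - (\<phi> - \<theta>)\<^sup>2) = sqrt (1 - r\<^sup>2) * arc_ratio ?x"
    using arc_ratio_pos[OF x] by (simp add: real_sqrt_mult)
  moreover have "unchart (rcis r \<theta>) = rcis r \<phi>"
    using unchart_chart[of "rcis r \<phi>"] assms by (simp add: chart_rcis)
  ultimately show ?thesis
    using assms(1) by (simp add: disc_dist_def chart_time_def)
qed

lemma disc_dist_boundary:
  assumes "0 < \<theta>" "\<theta> < 2 * pi"
  shows "((\<lambda>r. disc_dist (rcis r \<theta>)) \<longlongrightarrow> 2 * sqrt (\<theta> * (2 * pi - \<theta>))) (at_left 1)"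
proof -
  have "\<exists>\<phi>. chart_angle r \<phi> = \<theta>" if "0 \<le> r" "r < 1" for r
    using chart_angle_surj[OF that, of \<theta>] assms by (metis less_imp_le)
  then obtain \<phi> where \<phi>: "chart_angle r (\<phi> r) = \<theta>" if "0 \<le> r" "r < 1" for r
    by metis
  have lim: "(\<phi> \<longlongrightarrow> pi) (at_left 1)"
  proof (rule order_tendstoI)
    fix a assume "a < pi"
    \<comment> \<open>The maximum with pi / 2 keeps the test angle in (0, pi), where its image tends
      to 0 and so drops below \<open>\<theta>\<close>; by monotonicity the preimage of
      \<open>\<theta>\<close> lies to its right.\<close>
    define \<eta> where "\<eta> = max a (pi / 2)"
    have \<eta>: "0 < \<eta>" "\<eta> < pi" "a \<le> \<eta>" using \<open>a < pi\<close> by (auto simp: \<eta>_def less_max_iff_disj)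
    have "\<forall>\<^sub>F r in at_left 1. chart_angle r \<eta> < \<theta>"
      by (rule order_tendstoD(2)[OF chart_angle_tendsto[of \<eta>]]) (use \<eta> assms in auto)
    with eventually_at_left_1 show "\<forall>\<^sub>F r in at_left 1. a < \<phi> r"
    proof eventually_elim
      case (elim r)
      then have "\<eta> < \<phi> r"
        using chart_angle_less_iff[of r \<eta> "\<phi> r"] \<phi>[of r] by simp
      then show ?case using \<eta> by simp
    qed
  next
    fix a assume "pi < a"
    define \<eta> where "\<eta> = min a (3 * pi / 2)"
    have \<eta>: "pi < \<eta>" "\<eta> < 2 * pi" "\<eta> \<le> a" using \<open>pi < a\<close> by (auto simp: \<eta>_def min_less_iff_disj)
    have "\<forall>\<^sub>F r in at_left 1. \<theta> < chart_angle r \<eta>"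
      by (rule order_tendstoD(1)[OF chart_angle_tendsto[of \<eta>]]) (use \<eta> assms pi_gt_zero in auto)
    with eventually_at_left_1 show "\<forall>\<^sub>F r in at_left 1. \<phi> r < a"
    proof eventually_elim
      case (elim r)
      then have "\<phi> r < \<eta>"
        using chart_angle_less_iff[of r "\<phi> r" \<eta>] \<phi>[of r] by simp
      then show ?case using \<eta> by simp
    qed
  qed
  have "((\<lambda>r. arccos (r * cos (\<phi> r))) \<longlongrightarrow> arccos (-1)) (at_left 1)"
  proof (rule tendsto_arccos)
    show "((\<lambda>r. r * cos (\<phi> r)) \<longlongrightarrow> - 1) (at_left 1)"
      using lim by (auto intro!: tendsto_eq_intros)
    show "\<forall>\<^sub>F r in at_left 1. \<bar>r * cos (\<phi> r)\<bar> \<le> 1"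
      using eventually_at_left_1 by eventually_elim (use abs_mult_cos_less_1 in \<open>auto intro: less_imp_le\<close>)
  qed simp
  then have "((\<lambda>r. 2 * sqrt ((arccos (r * cos (\<phi> r)))\<^sup>2 - (\<phi> r - \<theta>)\<^sup>2))
      \<longlongrightarrow> 2 * sqrt ((arccos (-1))\<^sup>2 - (pi - \<theta>)\<^sup>2)) (at_left 1)"
    using lim by (intro tendsto_intros)
  moreover have "(arccos (-1))\<^sup>2 - (pi - \<theta>)\<^sup>2 = \<theta> * (2 * pi - \<theta>)"
    by (simp add: power2_eq_square algebra_simps)
  ultimately have "((\<lambda>r. 2 * sqrt ((arccos (r * cos (\<phi> r)))\<^sup>2 - (\<phi> r - \<theta>)\<^sup>2))
      \<longlongrightarrow> 2 * sqrt (\<theta> * (2 * pi - \<theta>))) (at_left 1)"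
    by simp
  then show ?thesis
  proof (rule Lim_transform_eventually)
    show "\<forall>\<^sub>F r in at_left 1. 2 * sqrt ((arccos (r * cos (\<phi> r)))\<^sup>2 - (\<phi> r - \<theta>)\<^sup>2) = disc_dist (rcis r \<theta>)"
      using eventually_at_left_1 by eventually_elim (simp add: disc_dist_rcis[OF _ _ \<phi>])
  qed
qed

section \<open>Horizontal curves in SU(2)\<close>

lemma su2_matrix_eq_iff: "su2_matrix a b = su2_matrix c d \<longleftrightarrow> a = c \<and> b = d"
  by (auto simp: su2_matrix_def vec_eq_iff forall_2)

lemma mat_1_eq_su2_matrix: "mat 1 = su2_matrix 1 0"
  by (simp add: su2_matrix_def vec_eq_iff forall_2 mat_def)

lemma SU2_E:
  assumes "g \<in> SU2"
  obtains a b where "g = su2_matrix a b" "(cmod a)\<^sup>2 + (cmod b)\<^sup>2 = 1"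
proof -
  define a b c d where abcd: "a = g $ 1 $ 1" "b = g $ 1 $ 2" "c = g $ 2 $ 1" "d = g $ 2 $ 2"
  have "g ** conj_transpose g = mat 1" and "det g = 1"
    using assms by (auto simp: SU2_def)
  then have eqs: "a * cnj a + b * cnj b = 1" "a * cnj c + b * cnj d = 0"
      "c * cnj a + d * cnj b = 0" "a * d - b * c = 1"
    by (auto simp: vec_eq_iff forall_2 matrix_matrix_mult_def conj_transpose_def sum_2 mat_def
        det_2 abcd)
  have "cnj a = d"
  proof -
    \<comment> \<open>The determinant 1 is inserted and a multiple of the vanishing product of the
      second row with the conjugate first row is added, which isolates \<open>d\<close>;
      \<open>c\<close> is found in the same way.\<close>
    have "cnj a = (a * d - b * c) * cnj a + b * (c * cnj a + d * cnj b)"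
      by (simp only: eqs) simp
    also have "\<dots> = d * (a * cnj a + b * cnj b)"
      by (simp add: algebra_simps)
    finally show ?thesis by (simp only: eqs) simp
  qed
  moreover have "- cnj b = c"
  proof -
    have "- cnj b = - (a * d - b * c) * cnj b + a * (c * cnj a + d * cnj b)"
      by (simp only: eqs) simp
    also have "\<dots> = c * (a * cnj a + b * cnj b)"
      by (simp add: algebra_simps)
    finally show ?thesis by (simp only: eqs) simp
  qed
  ultimately have "g = su2_matrix a b"
    by (auto simp: su2_matrix_def vec_eq_iff forall_2 abcd)
  moreover have "complex_of_real ((cmod a)\<^sup>2 + (cmod b)\<^sup>2) = 1"
    using eqs(1) by (simp only: of_real_add complex_norm_square)
  then have "(cmod a)\<^sup>2 + (cmod b)\<^sup>2 = 1"
    by (simp only: of_real_eq_1_iff)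
  ultimately show ?thesis using that by blast
qed

lemma norm_su2_matrix: "norm (su2_matrix a b) = sqrt (2 * ((cmod a)\<^sup>2 + (cmod b)\<^sup>2))"
  by (simp add: su2_matrix_def norm_vec_def L2_set_def sum_2)

lemma bounded_linear_su2_matrix: "bounded_linear (\<lambda>p. su2_matrix (fst p) (snd p))"
  unfolding linear_conv_bounded_linear[symmetric]
  by (rule linearI) (auto simp: su2_matrix_def vec_eq_iff forall_2)

lemma has_vector_derivative_su2_matrix:
  assumes "(a has_vector_derivative a') (at t within S)" "(b has_vector_derivative b') (at t within S)"
  shows "((\<lambda>t. su2_matrix (a t) (b t)) has_vector_derivative su2_matrix a' b') (at t within S)"
  using bounded_linear.has_vector_derivative[OF bounded_linear_su2_matrix
      has_vector_derivative_Pair[OF assms]] by simp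

text \<open>The vector x p1 + y p2 of the distribution is encoded by the complex number w = x + i y.\<close>

definition horizontal_vector :: "complex \<Rightarrow> complex \<Rightarrow> complex \<Rightarrow> complex^2^2" where
  "horizontal_vector a b w = su2_matrix (- (b * cnj w) / 2) (a * w / 2)"

lemma su2_matrix_mult_p:
  "su2_matrix a b ** (Re w *\<^sub>R p1 + Im w *\<^sub>R p2) = horizontal_vector a b w"
  by (auto simp: su2_matrix_def horizontal_vector_def p1_def p2_def vec_eq_iff forall_2
      matrix_matrix_mult_def sum_2 complex_eq_iff field_simps)

lemma p_space_eq: "p_space = range (\<lambda>w. Re w *\<^sub>R p1 + Im w *\<^sub>R p2)"
proof (intro equalityI subsetI)
  fix X assume "X \<in> p_space"
  then obtain x y where "X - x *\<^sub>R p1 = y *\<^sub>R p2"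
    by (auto simp: p_space_def span_breakdown_eq span_singleton)
  then have "X = Re (Complex x y) *\<^sub>R p1 + Im (Complex x y) *\<^sub>R p2"
    by (simp add: algebra_simps)
  then show "X \<in> range (\<lambda>w. Re w *\<^sub>R p1 + Im w *\<^sub>R p2)" by blast
qed (auto simp: p_space_def span_add span_scale span_base)

lemma distribution_su2_matrix: "distribution (su2_matrix a b) = range (horizontal_vector a b)"
  by (simp add: distribution_def p_space_eq image_image su2_matrix_mult_p)

lemma matrix_inv_SU2:
  assumes "g \<in> SU2"
  shows "matrix_inv g ** g = mat 1"
proof -
  have "\<exists>h. g ** h = mat 1 \<and> h ** g = mat 1"
    using assms by (auto simp: SU2_def)
  from someI_ex[OF this] show ?thesis
    unfolding matrix_inv_def by blast
qed

lemma metric_horizontal_vector: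
  assumes "(cmod a)\<^sup>2 + (cmod b)\<^sup>2 = 1"
  shows "sqrt (metric (su2_matrix a b) (horizontal_vector a b w) (horizontal_vector a b w)) = cmod w"
  unfolding metric_def su2_matrix_mult_p[symmetric] matrix_mul_assoc
    matrix_inv_SU2[OF su2_matrix_in_SU2[OF assms]] matrix_mul_lid p_inner_coordinates
  by (simp add: cmod_def power2_eq_square)

lemma metric_nonneg: "0 \<le> metric g v v"
  by (simp add: metric_def p_inner_def p1_neq_p2)

text \<open>Ties the sub-Riemannian speed to the ambient norm; the integrability of the speed and
  the Lipschitz constant of the geodesics come from here.\<close>

lemma norm_horizontal_vector:
  assumes "(cmod a)\<^sup>2 + (cmod b)\<^sup>2 = 1"
  shows "norm (horizontal_vector a b w) = cmod w / sqrt 2"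
proof -
  have *: "2 * ((cmod (- (b * cnj w) / 2))\<^sup>2 + (cmod (a * w / 2))\<^sup>2) =
    ((cmod a)\<^sup>2 + (cmod b)\<^sup>2) * (cmod w)\<^sup>2 / 2"
    by (simp add: norm_mult norm_divide power_mult_distrib power_divide field_simps)
  show ?thesis
    unfolding horizontal_vector_def norm_su2_matrix * assms by (simp add: real_sqrt_divide)
qed

text \<open>The derivative of \<open>b\<close> is dropped, because the lower bound uses only |b|,
  which \<open>a\<close> determines.\<close>

lemma horizontal_E:
  assumes "horizontal T \<gamma>"
  obtains a b L N w where "0 < T" "\<And>t. t \<in> {0..T} \<Longrightarrow> \<gamma> t = su2_matrix (a t) (b t)"
    "\<And>t. t \<in> {0..T} \<Longrightarrow> (cmod (a t))\<^sup>2 + (cmod (b t))\<^sup>2 = 1"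
    "L-lipschitz_on {0..T} a" "negligible N"
    "\<And>t. t \<in> {0..T} - N \<Longrightarrow> (a has_vector_derivative - (b t * cnj (w t)) / 2) (at t within {0..T})"
    "((\<lambda>t. cmod (w t)) has_integral curve_length T \<gamma>) {0..T}"
proof -
  define a where "a t = \<gamma> t $ 1 $ 1" for t
  define b where "b t = \<gamma> t $ 1 $ 2" for t
  have T: "0 < T" using assms by (simp add: horizontal_def)
  have ab: "\<gamma> t = su2_matrix (a t) (b t)" "(cmod (a t))\<^sup>2 + (cmod (b t))\<^sup>2 = 1" if "t \<in> {0..T}" for t
  proof -
    have "\<gamma> t \<in> SU2" using assms that by (auto simp: horizontal_def)
    then obtain c d where cd: "\<gamma> t = su2_matrix c d" "(cmod c)\<^sup>2 + (cmod d)\<^sup>2 = 1"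
      by (rule SU2_E)
    then have "a t = c" "b t = d"
      by (simp_all add: a_def b_def su2_matrix_def)
    then show "\<gamma> t = su2_matrix (a t) (b t)" "(cmod (a t))\<^sup>2 + (cmod (b t))\<^sup>2 = 1"
      using cd by simp_all
  qed
  obtain L where L: "L-lipschitz_on {0..T} \<gamma>"
    using assms by (auto simp: horizontal_def)
  have "L-lipschitz_on {0..T} a"
  proof (rule lipschitz_onI)
    fix s t assume st: "s \<in> {0..T}" "t \<in> {0..T}"
    have "dist (a s) (a t) \<le> dist (\<gamma> s $ 1) (\<gamma> t $ 1)"
      unfolding a_def by (rule dist_vec_nth_le)
    also have "\<dots> \<le> dist (\<gamma> s) (\<gamma> t)" by (rule dist_vec_nth_le)
    also have "\<dots> \<le> L * dist s t" by (rule lipschitz_onD[OF L st])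
    finally show "dist (a s) (a t) \<le> L * dist s t" .
  qed (rule lipschitz_on_nonneg[OF L])
  have "AE t in lebesgue_on {0..T}.
      \<gamma> differentiable (at t within {0..T}) \<and> velocity T \<gamma> t \<in> distribution (\<gamma> t)"
    using assms by (simp only: horizontal_def)
  then have "AE t in lebesgue. t \<in> {0..T} \<longrightarrow>
      \<gamma> differentiable (at t within {0..T}) \<and> velocity T \<gamma> t \<in> distribution (\<gamma> t)"
    by (rule AE_restrict_space_iff[THEN iffD1, rotated]) simp
  then obtain N where N: "negligible N" and
    diff: "\<And>t. t \<in> {0..T} - N \<Longrightarrow> \<gamma> differentiable (at t within {0..T}) \<and> velocity T \<gamma> t \<in> distribution (\<gamma> t)"
    unfolding eventually_ae_filter_negligible by blast
  have \<gamma>': "(\<gamma> has_vector_derivative velocity T \<gamma> t) (at t within {0..T})" if "t \<in> {0..T} - N" for t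
    using diff[OF that] unfolding velocity_def by (simp add: vector_derivative_works)
  have "\<exists>w. velocity T \<gamma> t = horizontal_vector (a t) (b t) w" if "t \<in> {0..T} - N" for t
    using diff[OF that] ab(1)[of t] that by (auto simp: distribution_su2_matrix)
  then obtain w where w: "\<And>t. t \<in> {0..T} - N \<Longrightarrow> velocity T \<gamma> t = horizontal_vector (a t) (b t) (w t)"
    by metis
  have a': "(a has_vector_derivative - (b t * cnj (w t)) / 2) (at t within {0..T})"
    if "t \<in> {0..T} - N" for t
  proof -
    have "bounded_linear (\<lambda>x::complex^2^2. x $ 1 $ 1)"
      using bounded_linear_compose[OF bounded_linear_vec_nth bounded_linear_vec_nth] .
    from bounded_linear.has_vector_derivative[OF this \<gamma>'[OF that]]
    show ?thesis
      unfolding w[OF that] a_def by (simp add: horizontal_vector_def su2_matrix_def)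
  qed
  have "velocity T \<gamma> absolutely_integrable_on {0..T}"
    by (rule fundamental_theorem_of_calculus_lipschitz(2)[OF _ L N \<gamma>']) (use T in auto)
  then have int: "(\<lambda>t. sqrt 2 * norm (velocity T \<gamma> t)) integrable_on {0..T}"
    by (intro integrable_on_mult_right) (simp add: absolutely_integrable_on_def)
  have speed: "sqrt (metric (\<gamma> t) (velocity T \<gamma> t) (velocity T \<gamma> t)) = cmod (w t)"
    "sqrt 2 * norm (velocity T \<gamma> t) = cmod (w t)" if "t \<in> {0..T} - N" for t
    using w[OF that] ab[of t] that metric_horizontal_vector norm_horizontal_vector by auto
  \<comment> \<open>On a function that is not integrable, \<open>integral\<close> would return its
    default 0, so integrability must be established before \<open>curve_length\<close> can be
    used.\<close>
  have "(\<lambda>t. sqrt (metric (\<gamma> t) (velocity T \<gamma> t) (velocity T \<gamma> t))) integrable_on {0..T}"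
    by (rule integrable_spike[OF int N]) (simp add: speed)
  then have "((\<lambda>t. sqrt (metric (\<gamma> t) (velocity T \<gamma> t) (velocity T \<gamma> t)))
      has_integral curve_length T \<gamma>) {0..T}"
    unfolding curve_length_def by (rule integrable_integral)
  then have "((\<lambda>t. cmod (w t)) has_integral curve_length T \<gamma>) {0..T}"
    by (rule has_integral_spike[OF N, rotated]) (simp add: speed)
  then show ?thesis
    using that T ab \<open>L-lipschitz_on {0..T} a\<close> N a' by blast
qed

lemma curve_length_nonneg: "0 \<le> curve_length T \<gamma>"
proof (cases "(\<lambda>t. sqrt (metric (\<gamma> t) (velocity T \<gamma> t) (velocity T \<gamma> t))) integrable_on {0..T}")
  case True
  then show ?thesis unfolding curve_length_def by (rule integral_nonneg) (simp add: metric_nonneg)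
qed (simp add: curve_length_def not_integrable_integral)

section \<open>The lower bound for lengths\<close>

text \<open>Makes the composition with a contracted curve Lipschitz, so that the fundamental theorem
  applies; the sharp estimate comes from the pointwise derivative. The constant is the eikonal norm
  on the circle of radius r, its maximum.\<close>

lemma lipschitz_disc_dist:
  assumes "0 \<le> r" "r < 1"
  shows "(2 / sqrt (1 - r\<^sup>2))-lipschitz_on (cball 0 r) disc_dist"
proof -
  have r: "\<bar>r\<bar> < 1" using assms by simp
  have "\<exists>e. cmod e = 1 \<and>
    (disc_dist has_derivative (\<lambda>v. - (2 / sqrt (1 - (cmod x)\<^sup>2)) * Re (e * v))) (at x)"
    if "x \<in> cball 0 r" for x
    using has_derivative_disc_dist[of x] that assms by (metis mem_cball_0 le_less_trans)
  then obtain e where e: "\<And>x. x \<in> cball 0 r \<Longrightarrow> cmod (e x) = 1"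
    "\<And>x. x \<in> cball 0 r \<Longrightarrow> (disc_dist has_derivative
      (\<lambda>v. - (2 / sqrt (1 - (cmod x)\<^sup>2)) * Re (e x * v))) (at x)"
    by metis
  have onorm: "onorm (\<lambda>v. - (2 / sqrt (1 - (cmod x)\<^sup>2)) * Re (e x * v)) \<le> 2 / sqrt (1 - r\<^sup>2)"
    if "x \<in> cball 0 r" for x
  proof (rule onorm_bound)
    fix v
    have "(cmod x)\<^sup>2 \<le> r\<^sup>2"
      using that by (intro power_mono) auto
    then have "2 / sqrt (1 - (cmod x)\<^sup>2) \<le> 2 / sqrt (1 - r\<^sup>2)"
      using one_minus_square_pos[OF r] by (intro divide_left_mono mult_pos_pos) auto
    moreover have "\<bar>Re (e x * v)\<bar> \<le> cmod v"
      using abs_Re_le_cmod[of "e x * v"] e(1)[OF that] by (simp add: norm_mult)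
    moreover have "0 \<le> 2 / sqrt (1 - (cmod x)\<^sup>2)"
      using that assms by (simp add: abs_square_le_1)
    moreover have "0 \<le> 2 / sqrt (1 - r\<^sup>2)"
      using one_minus_square_pos[OF r] by simp
    ultimately have "2 / sqrt (1 - (cmod x)\<^sup>2) * \<bar>Re (e x * v)\<bar> \<le> 2 / sqrt (1 - r\<^sup>2) * cmod v"
      by (intro mult_mono) auto
    moreover have "norm (- (2 / sqrt (1 - (cmod x)\<^sup>2)) * Re (e x * v)) =
        2 / sqrt (1 - (cmod x)\<^sup>2) * \<bar>Re (e x * v)\<bar>"
      using \<open>0 \<le> 2 / sqrt (1 - (cmod x)\<^sup>2)\<close> unfolding real_norm_def abs_mult abs_minus_cancel
      by (simp only: abs_of_nonneg)
    ultimately show "norm (- (2 / sqrt (1 - (cmod x)\<^sup>2)) * Re (e x * v)) \<le> 2 / sqrt (1 - r\<^sup>2) * norm v"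
      by simp
  qed (use one_minus_square_pos[OF r] in simp)
  have deriv: "(disc_dist has_derivative (\<lambda>v. - (2 / sqrt (1 - (cmod x)\<^sup>2)) * Re (e x * v)))
      (at x within cball 0 r)" if "x \<in> cball 0 r" for x
    using e(2)[OF that] by (rule has_derivative_at_withinI)
  show ?thesis
  proof (rule lipschitz_onI)
    show "dist (disc_dist x) (disc_dist y) \<le> 2 / sqrt (1 - r\<^sup>2) * dist x y"
      if "x \<in> cball 0 r" "y \<in> cball 0 r" for x y
      using differentiable_bound[OF convex_cball deriv onorm that] by (simp only: dist_norm)
  qed (use one_minus_square_pos[OF r] in simp)
qed

text \<open>With |a|, |b| and |w| for \<open>A\<close>, \<open>B\<close> and
  \<open>\<omega>\<close>, the left side is the speed of the contracted projection. As A^2 + B^2 =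
  1, the decisive inequality (r B)^2 < 1 - (r A)^2 just says r^2 < 1.\<close>

lemma scaled_speed_le:
  fixes A B r \<omega> :: real
  assumes "A\<^sup>2 + B\<^sup>2 = 1" "0 \<le> r" "r < 1" "0 \<le> B" "0 \<le> \<omega>"
  shows "2 / sqrt (1 - (r * A)\<^sup>2) * (r * (B * \<omega> / 2)) \<le> \<omega>"
proof -
  have r: "0 < 1 - r\<^sup>2" using assms by (intro one_minus_square_pos) simp
  have "(r * B)\<^sup>2 = r\<^sup>2 * (A\<^sup>2 + B\<^sup>2) - (r * A)\<^sup>2"
    by (simp add: algebra_simps power_mult_distrib)
  then have rB: "(r * B)\<^sup>2 < 1 - (r * A)\<^sup>2"
    using r assms(1) by simp
  then have "r * B \<le> sqrt (1 - (r * A)\<^sup>2)"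
    by (intro real_le_rsqrt) simp
  moreover have "0 < sqrt (1 - (r * A)\<^sup>2)"
    using rB zero_le_power2[of "r * B"] by (intro real_sqrt_gt_zero) linarith
  ultimately have "r * B / sqrt (1 - (r * A)\<^sup>2) * \<omega> \<le> 1 * \<omega>"
    using assms(5) by (intro mult_right_mono) simp_all
  then show ?thesis by (simp add: mult.assoc)
qed

text \<open>Shrinking the projection of the curve to the unit disc by the factor r does not increase its
  length and moves it into the open disc, where \<^const>\<open>disc_dist\<close> is differentiable.\<close>

lemma curve_length_ge_disc_dist:
  assumes "horizontal T \<gamma>" and ends: "\<gamma> 0 = su2_matrix \<alpha> \<beta>" "\<gamma> T = mat 1"
    and r: "0 \<le> r" "r < 1"
  shows "disc_dist (of_real r * \<alpha>) - disc_dist (of_real r) \<le> curve_length T \<gamma>"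
proof -
  obtain a b L N w where T: "0 < T"
    and \<gamma>: "\<And>t. t \<in> {0..T} \<Longrightarrow> \<gamma> t = su2_matrix (a t) (b t)"
    and ab: "\<And>t. t \<in> {0..T} \<Longrightarrow> (cmod (a t))\<^sup>2 + (cmod (b t))\<^sup>2 = 1"
    and L: "L-lipschitz_on {0..T} a" and N: "negligible N"
    and a': "\<And>t. t \<in> {0..T} - N \<Longrightarrow>
      (a has_vector_derivative - (b t * cnj (w t)) / 2) (at t within {0..T})"
    and len: "((\<lambda>t. cmod (w t)) has_integral curve_length T \<gamma>) {0..T}"
    using horizontal_E[OF assms(1)] by blast
  define h where "h t = disc_dist (of_real r * a t)" for t
  have h_eq: "h = (\<lambda>t. disc_dist (of_real r * a t))"
    by (simp add: h_def fun_eq_iff)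
  have a_le: "cmod (of_real r * a t) \<le> r" if "t \<in> {0..T}" for t
  proof -
    have "cmod (a t) \<le> 1"
      using ab[OF that] abs_square_le_1[of "cmod (a t)"] zero_le_power2[of "cmod (b t)"] by simp
    then show ?thesis
      using r by (simp add: norm_mult mult_left_le)
  qed
  have ra: "(r * L)-lipschitz_on {0..T} (\<lambda>t. of_real r * a t)"
  proof (rule lipschitz_onI)
    fix s t assume "s \<in> {0..T}" "t \<in> {0..T}"
    then have "r * dist (a s) (a t) \<le> r * (L * dist s t)"
      using lipschitz_onD[OF L] r(1) by (intro mult_left_mono)
    then show "dist (of_real r * a s) (of_real r * a t) \<le> r * L * dist s t"
      using r(1) by (simp add: dist_norm norm_mult flip: right_diff_distrib)
  qed (use r lipschitz_on_nonneg[OF L] in simp)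
  have "(2 / sqrt (1 - r\<^sup>2))-lipschitz_on ((\<lambda>t. of_real r * a t) ` {0..T}) disc_dist"
    by (rule lipschitz_on_subset[OF lipschitz_disc_dist[OF r]]) (use a_le in auto)
  from lipschitz_on_compose[OF ra this]
  have h_lip: "(2 / sqrt (1 - r\<^sup>2) * (r * L))-lipschitz_on {0..T} h"
    unfolding h_eq by (simp only: o_def)
  have *: "\<exists>d. (h has_vector_derivative d) (at t within {0..T}) \<and> \<bar>d\<bar> \<le> cmod (w t)"
    if t: "t \<in> {0..T} - N" for t
  proof -
    let ?p = "of_real r * a t" and ?v = "of_real r * (- (b t * cnj (w t)) / 2)"
    have "cmod ?p < 1" using a_le[of t] t r by auto
    then obtain e where e: "cmod e = 1"
      "(disc_dist has_derivative (\<lambda>v. - (2 / sqrt (1 - (cmod ?p)\<^sup>2)) * Re (e * v))) (at ?p)"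
      by (rule has_derivative_disc_dist)
    have "((\<lambda>t. of_real r * a t) has_vector_derivative ?v) (at t within {0..T})"
      by (rule has_vector_derivative_mult_right[OF a'[OF t]])
    from vector_derivative_diff_chain_within[OF this has_derivative_at_withinI[OF e(2)]]
    have "(h has_vector_derivative - (2 / sqrt (1 - (cmod ?p)\<^sup>2)) * Re (e * ?v)) (at t within {0..T})"
      unfolding h_eq by (simp only: o_def)
    moreover have "\<bar>- (2 / sqrt (1 - (cmod ?p)\<^sup>2)) * Re (e * ?v)\<bar> \<le> cmod (w t)"
    proof -
      have "0 \<le> 2 / sqrt (1 - (cmod ?p)\<^sup>2)"
        using \<open>cmod ?p < 1\<close> by (simp add: abs_square_le_1 flip: norm_mult)
      then have "\<bar>- (2 / sqrt (1 - (cmod ?p)\<^sup>2)) * Re (e * ?v)\<bar>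
          \<le> 2 / sqrt (1 - (cmod ?p)\<^sup>2) * cmod ?v"
        using abs_Re_le_cmod[of "e * ?v"] e(1) unfolding abs_mult abs_minus_cancel norm_mult[of e]
        by (simp only: abs_of_nonneg mult_1) (rule mult_left_mono)
      also have "\<dots> = 2 / sqrt (1 - (r * cmod (a t))\<^sup>2) * (r * (cmod (b t) * cmod (w t) / 2))"
        using r(1) by (simp add: norm_mult norm_divide)
      also have "\<dots> \<le> cmod (w t)"
        by (rule scaled_speed_le) (use ab t r in auto)
      finally show ?thesis .
    qed
    ultimately show ?thesis by blast
  qed
  \<comment> \<open>The integrals are compared below by a bound at every time, so \<open>d\<close>
    needs a value on \<open>N\<close> too; 0 serves.\<close>
  have "\<exists>d. (t \<notin> N \<longrightarrow> (h has_vector_derivative d) (at t within {0..T})) \<and> \<bar>d\<bar> \<le> cmod (w t)"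
    if "t \<in> {0..T}" for t
    using *[of t] that by (cases "t \<in> N") (auto intro: exI[of _ 0])
  then obtain d where d:
    "\<And>t. t \<in> {0..T} - N \<Longrightarrow> (h has_vector_derivative d t) (at t within {0..T})"
    "\<And>t. t \<in> {0..T} \<Longrightarrow> \<bar>d t\<bar> \<le> cmod (w t)"
    by (metis DiffE)
  have "(d has_integral h T - h 0) {0..T}"
    by (rule fundamental_theorem_of_calculus_lipschitz(1)[OF _ h_lip N d(1)]) (use T in auto)
  \<comment> \<open>The curve runs towards the identity, so the quantity to bound is the drop
    \<open>h 0 - h T\<close>.\<close>
  from has_integral_neg[OF this] have "- (h T - h 0) \<le> curve_length T \<gamma>"
    by (rule has_integral_le[OF _ len]) (use d(2) in fastforce)
  moreover have "a 0 = \<alpha>" "a T = 1"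
    using \<gamma>[of 0] \<gamma>[of T] T ends by (auto simp: mat_1_eq_su2_matrix su2_matrix_eq_iff)
  ultimately show ?thesis by (simp add: h_def)
qed

lemma curve_length_ge_limit:
  assumes "horizontal T \<gamma>" "\<gamma> 0 = su2_matrix \<alpha> \<beta>" "\<gamma> T = mat 1"
    and "((\<lambda>r. disc_dist (of_real r * \<alpha>)) \<longlongrightarrow> l) (at_left 1)"
  shows "l \<le> curve_length T \<gamma>"
proof (rule tendsto_upperbound)
  show "((\<lambda>r. disc_dist (of_real r * \<alpha>) - disc_dist (of_real r)) \<longlongrightarrow> l) (at_left 1)"
    using tendsto_diff[OF assms(4) tendsto_disc_dist_1] by simp
  show "\<forall>\<^sub>F r in at_left 1. disc_dist (of_real r * \<alpha>) - disc_dist (of_real r) \<le> curve_length T \<gamma>"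
    using eventually_at_left_1 by eventually_elim (use curve_length_ge_disc_dist[OF assms(1-3)] in auto)
qed simp

section \<open>Explicit geodesics\<close>

text \<open>The pair is the first row of exp (t (A + c k)) exp (- t c k), where A is the unit vector
  encoded by \<open>\<omega>\<close> and k generates the diagonal subgroup. Its control is A rotated
  at the constant rate c.\<close>

lemma geodesic_derivatives:
  fixes c :: real and \<omega> :: complex
  defines "s \<equiv> sqrt (1 + c\<^sup>2)"
  defines "a \<equiv> \<lambda>t. cis (- (c * t / 2)) * geodesic_point c t"
    and "b \<equiv> \<lambda>t. \<omega> * cis (c * t / 2) * of_real (sin (s * t / 2) / s)"
  assumes "cmod \<omega> = 1"
  shows "(a has_vector_derivative - (b t * cnj (\<omega> * cis (c * t))) / 2) (at t)"
    and "(b has_vector_derivative a t * (\<omega> * cis (c * t)) / 2) (at t)"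
    and "(cmod (a t))\<^sup>2 + (cmod (b t))\<^sup>2 = 1"
proof -
  have s: "0 < s" "s\<^sup>2 = 1 + c\<^sup>2"
    using add_pos_nonneg[OF zero_less_one zero_le_power2[of c]] by (auto simp: s_def)
  let ?S = "sin (s * t / 2)" and ?C = "cos (s * t / 2)"
  have a_eq: "a = (\<lambda>t. cis (- (c * t / 2)) * (of_real (cos (s * t / 2)) + \<i> * of_real (c / s * sin (s * t / 2))))"
    by (simp add: a_def geodesic_point_def s_def Let_def fun_eq_iff complex_eq_iff)
  define E where "E = cis (c * t / 2)"
  have E: "cis (- (c * t / 2)) = cnj E" "cis (c * t) = E * E" "E * cnj E = 1"
    by (simp_all add: E_def cis_cnj cis_mult)
  have cis': "((\<lambda>t. cis (k * t / 2)) has_vector_derivative of_real (k / 2) * (\<i> * cis (k * t / 2))) (at t)" for k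
    unfolding has_vector_derivative_def
    by (auto intro!: derivative_eq_intros simp: scaleR_conv_of_real algebra_simps)
  have cos': "((\<lambda>t. complex_of_real (cos (s * t / 2))) has_vector_derivative of_real (- ?S * (s / 2))) (at t)"
    by (rule has_vector_derivative_of_real) (auto intro!: derivative_eq_intros)
  have sin': "((\<lambda>t. complex_of_real (k * sin (s * t / 2))) has_vector_derivative of_real (k * (?C * (s / 2)))) (at t)" for k
    by (rule has_vector_derivative_of_real) (auto intro!: derivative_eq_intros)
  show "(cmod (a t))\<^sup>2 + (cmod (b t))\<^sup>2 = 1"
  proof -
    have "(cmod (a t))\<^sup>2 = ?C\<^sup>2 + (c / s * ?S)\<^sup>2"
      by (simp add: a_def norm_mult geodesic_point_def Let_def cmod_power2 flip: s_def)
    moreover have "(cmod (b t))\<^sup>2 = (?S / s)\<^sup>2"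
      by (simp add: b_def norm_mult norm_divide power_divide assms(4))
    moreover have "s\<^sup>2 * ?C\<^sup>2 + c\<^sup>2 * ?S\<^sup>2 + ?S\<^sup>2 = s\<^sup>2"
      unfolding s(2) cos_squared_eq by (simp add: algebra_simps)
    moreover from this have "?C\<^sup>2 + (c / s * ?S)\<^sup>2 + (?S / s)\<^sup>2 = 1"
      using s(1) by (simp add: field_simps power_mult_distrib power_divide)
    ultimately show ?thesis by simp
  qed
  have "(a has_vector_derivative
      cnj E * (of_real (- ?S * (s / 2)) + \<i> * of_real (c / s * (?C * (s / 2))))
      + of_real (- c / 2) * (\<i> * cnj E) * (of_real ?C + \<i> * of_real (c / s * ?S))) (at t)"
    unfolding a_eq using has_vector_derivative_mult[OF cis'[of "- c"]
        has_vector_derivative_add[OF cos' has_vector_derivative_mult_right[OF sin'[of "c / s"]]]]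
    by (simp add: E(1))
  moreover have "cnj E * (of_real (- ?S * (s / 2)) + \<i> * of_real (c / s * (?C * (s / 2))))
      + of_real (- c / 2) * (\<i> * cnj E) * (of_real ?C + \<i> * of_real (c / s * ?S))
      = - (b t * cnj (\<omega> * cis (c * t))) / 2"
  proof -
    \<comment> \<open>The rotation contributes c^2 / (2 s) against s / 2, and s^2 - c^2 = 1 leaves 1
      / (2 s). The second equation lets the cosine terms cancel.\<close>
    have 1: "- ?S * (s / 2) + c / 2 * (c / s * ?S) = - (?S / s) / 2" "c / s * (?C * (s / 2)) = c / 2 * ?C"
    proof -
      have "- ?S * (s / 2) + c / 2 * (c / s * ?S) = - (?S / s) / 2 * (s\<^sup>2 - c\<^sup>2)"
        using s(1) by (simp add: field_simps power2_eq_square)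
      then show "- ?S * (s / 2) + c / 2 * (c / s * ?S) = - (?S / s) / 2"
        unfolding s(2) by simp
    qed (use s(1) in simp)
    have "cnj E * (of_real (- ?S * (s / 2)) + \<i> * of_real (c / s * (?C * (s / 2))))
      + of_real (- c / 2) * (\<i> * cnj E) * (of_real ?C + \<i> * of_real (c / s * ?S))
      = cnj E * of_real (- ?S * (s / 2) + c / 2 * (c / s * ?S))"
      unfolding 1(2) by (simp add: algebra_simps)
    also have "\<dots> = - ((\<omega> * cnj \<omega>) * (E * cnj E) * cnj E * of_real (?S / s)) / 2"
      unfolding 1(1) E(3) using assms(4) by (simp flip: complex_norm_square)
    also have "\<dots> = - (b t * cnj (\<omega> * cis (c * t))) / 2"
      unfolding E(2) b_def E_def[symmetric] by simp
    finally show ?thesis .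
  qed
  ultimately show "(a has_vector_derivative - (b t * cnj (\<omega> * cis (c * t))) / 2) (at t)"
    by metis
  have "(b has_vector_derivative
      (\<omega> * E) * of_real (1 / s * (?C * (s / 2))) + \<omega> * (of_real (c / 2) * (\<i> * E)) * of_real (1 / s * ?S)) (at t)"
    unfolding b_def using has_vector_derivative_mult[OF
        has_vector_derivative_mult_right[OF cis'[of c]] sin'[of "1 / s"], of \<omega>]
    by (simp add: E_def)
  moreover have "(\<omega> * E) * of_real (1 / s * (?C * (s / 2))) + \<omega> * (of_real (c / 2) * (\<i> * E)) * of_real (1 / s * ?S)
    = a t * (\<omega> * cis (c * t)) / 2"
  proof -
    have "a t * (\<omega> * cis (c * t)) / 2 = (E * cnj E) * (of_real ?C + \<i> * of_real (c / s * ?S)) * \<omega> * E / 2"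
      unfolding a_eq E(1,2) by simp
    also have "\<dots> = (\<omega> * E) * of_real (1 / s * (?C * (s / 2))) + \<omega> * (of_real (c / 2) * (\<i> * E)) * of_real (1 / s * ?S)"
      unfolding E(3) using s(1) by (simp add: field_simps)
    finally show ?thesis by simp
  qed
  ultimately show "(b has_vector_derivative a t * (\<omega> * cis (c * t)) / 2) (at t)"
    by metis
qed

text \<open>The constant speed \<open>k\<close> may be 0, which covers the constant curve.\<close>

lemma horizontal_unit_speed:
  assumes "0 < T" and ab: "\<And>t. (cmod (a t))\<^sup>2 + (cmod (b t))\<^sup>2 = 1"
    and deriv: "\<And>t. ((\<lambda>t. su2_matrix (a t) (b t)) has_vector_derivative
      horizontal_vector (a t) (b t) (w t)) (at t)"
    and w: "\<And>t. cmod (w t) = k"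
  shows "horizontal T (\<lambda>t. su2_matrix (a t) (b t))"
    and "curve_length T (\<lambda>t. su2_matrix (a t) (b t)) = k * T"
proof -
  let ?\<gamma> = "\<lambda>t. su2_matrix (a t) (b t)"
  have k: "0 \<le> k" using w[of 0] by (metis norm_ge_zero)
  have velocity: "velocity T ?\<gamma> t = horizontal_vector (a t) (b t) (w t)" if "t \<in> {0..T}" for t
    unfolding velocity_def using deriv that \<open>0 < T\<close>
    by (intro vector_derivative_at_within_ivl) auto
  have "(k / sqrt 2)-lipschitz_on {0..T} ?\<gamma>"
  proof (rule lipschitz_onI)
    fix s t :: real
    have "norm (?\<gamma> s - ?\<gamma> t) \<le> (k / sqrt 2) * norm (s - t)"
    proof (rule differentiable_bound[where S = UNIV])
      show "(?\<gamma> has_derivative (\<lambda>h. h *\<^sub>R horizontal_vector (a x) (b x) (w x))) (at x within UNIV)" for x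
        using deriv[of x] by (simp add: has_vector_derivative_def)
      show "onorm (\<lambda>h. h *\<^sub>R horizontal_vector (a x) (b x) (w x)) \<le> k / sqrt 2" for x
        using k by (intro onorm_bound) (simp_all add: norm_horizontal_vector[OF ab] w mult.commute)
    qed auto
    then show "dist (?\<gamma> s) (?\<gamma> t) \<le> (k / sqrt 2) * dist s t"
      by (simp add: dist_norm)
  qed (use k in simp)
  moreover have "?\<gamma> differentiable (at t within {0..T})" for t
    using deriv[of t] has_vector_derivative_at_within differentiableI_vector by blast
  moreover have "velocity T ?\<gamma> t \<in> distribution (?\<gamma> t)" if "t \<in> {0..T}" for t
    using velocity[OF that] by (auto simp: distribution_su2_matrix)
  ultimately show "horizontal T ?\<gamma>"
    unfolding horizontal_def using \<open>0 < T\<close> su2_matrix_in_SU2[OF ab] by (auto intro!: AE_I2)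
  have "curve_length T ?\<gamma> = integral {0..T} (\<lambda>t. k)"
    unfolding curve_length_def
    by (rule integral_cong) (simp add: velocity metric_horizontal_vector[OF ab] w)
  then show "curve_length T ?\<gamma> = k * T"
    using \<open>0 < T\<close> by simp
qed

text \<open>Without an upper bound on \<open>t\<close>, this includes sqrt (1 + c^2) t / 2 = pi, the
  first return to the diagonal subgroup, where \<open>\<beta>\<close> is 0.\<close>

lemma geodesic_to_identity:
  assumes "0 < t" "cmod \<omega> = 1"
    and \<alpha>: "\<alpha> = cis (- (c * t / 2)) * geodesic_point c t"
    and \<beta>: "\<beta> = \<omega> * cis (c * t / 2) * of_real (sin (sqrt (1 + c\<^sup>2) * t / 2) / sqrt (1 + c\<^sup>2))"
  shows "\<exists>\<gamma>. horizontal t \<gamma> \<and> \<gamma> 0 = su2_matrix \<alpha> \<beta> \<and> \<gamma> t = mat 1 \<and> curve_length t \<gamma> = t"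
proof -
  define a where "a t = cis (- (c * t / 2)) * geodesic_point c t" for t
  define b where "b t = \<omega> * cis (c * t / 2) * of_real (sin (sqrt (1 + c\<^sup>2) * t / 2) / sqrt (1 + c\<^sup>2))" for t
  \<comment> \<open>The geodesic is run backwards, from the given point to the identity, which
    changes the sign of the control.\<close>
  define w where "w \<tau> = - (\<omega> * cis (c * (t - \<tau>)))" for \<tau>
  note geodesic = geodesic_derivatives[OF assms(2), of c, folded a_def b_def]
  have reverse: "((\<lambda>\<tau>. t - \<tau>) has_vector_derivative - 1) (at \<tau>)" for \<tau> :: real
    by (auto intro!: derivative_eq_intros)
  have "((\<lambda>\<tau>. su2_matrix (a (t - \<tau>)) (b (t - \<tau>))) has_vector_derivative
      horizontal_vector (a (t - \<tau>)) (b (t - \<tau>)) (w \<tau>)) (at \<tau>)" for \<tau>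
  proof -
    note ab' = vector_diff_chain_at[OF reverse geodesic(1)] vector_diff_chain_at[OF reverse geodesic(2)]
    show ?thesis
      using has_vector_derivative_su2_matrix[OF ab'[of \<tau>]]
      by (simp add: horizontal_vector_def w_def o_def)
  qed
  from horizontal_unit_speed[OF \<open>0 < t\<close> geodesic(3) this]
  have "horizontal t (\<lambda>\<tau>. su2_matrix (a (t - \<tau>)) (b (t - \<tau>)))"
    "curve_length t (\<lambda>\<tau>. su2_matrix (a (t - \<tau>)) (b (t - \<tau>))) = t"
    using assms(2) by (auto simp: w_def norm_mult)
  moreover have "a 0 = 1" "b 0 = 0"
    by (simp_all add: a_def b_def geodesic_point_def Let_def complex_eq_iff)
  moreover have "\<alpha> = a t" "\<beta> = b t"
    using \<alpha> \<beta> by (simp_all only: a_def b_def)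
  ultimately show ?thesis
    by (intro exI[of _ "\<lambda>\<tau>. su2_matrix (a (t - \<tau>)) (b (t - \<tau>))"])
      (simp add: mat_1_eq_su2_matrix)
qed

text \<open>Horizontal curves live on intervals of positive length, so the identity is joined to
  itself by standing still.\<close>

lemma constant_curve_at_identity:
  "\<exists>\<gamma>. horizontal 1 \<gamma> \<and> \<gamma> 0 = mat 1 \<and> \<gamma> 1 = mat 1 \<and> curve_length 1 \<gamma> = 0"
proof -
  have "((\<lambda>t. su2_matrix 1 0) has_vector_derivative horizontal_vector 1 0 0) (at t)" for t :: real
  proof -
    have "horizontal_vector 1 0 0 = 0"
      by (simp add: horizontal_vector_def su2_matrix_def vec_eq_iff forall_2)
    then show ?thesis by simp
  qed
  then show ?thesis
    using horizontal_unit_speed[of 1 "\<lambda>_. 1" "\<lambda>_. 0" "\<lambda>_. 0" 0]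
    by (intro exI[of _ "\<lambda>_. su2_matrix 1 0"]) (simp add: mat_1_eq_su2_matrix)
qed

section \<open>The value of the distance\<close>

lemma sub_riemannian_dist_eqI:
  assumes "horizontal T \<gamma>" "\<gamma> 0 = p" "\<gamma> T = q" "curve_length T \<gamma> = l"
    and "\<And>T \<gamma>. horizontal T \<gamma> \<Longrightarrow> \<gamma> 0 = p \<Longrightarrow> \<gamma> T = q \<Longrightarrow> l \<le> curve_length T \<gamma>"
  shows "sub_riemannian_dist p q = l"
  unfolding sub_riemannian_dist_def using assms by (intro cInf_eq_minimum) blast+

theorem theorem2:
  fixes \<alpha> \<beta> :: complex and \<theta> :: real
  assumes "(cmod \<alpha>)\<^sup>2 + (cmod \<beta>)\<^sup>2 = 1"
    and "is_Arg \<alpha> \<theta>" and "\<theta> \<in> {0..2 * pi}"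
  shows "(\<beta> \<noteq> 0 \<longrightarrow> (\<exists>!p. psi_system \<alpha> (fst p) (snd p)))
    \<and> sub_riemannian_dist (su2_matrix \<alpha> \<beta>) (mat 1) =
        (if \<beta> = 0 then 2 * sqrt (\<theta> * (2 * pi - \<theta>)) else psi \<alpha>)"
proof (cases "\<beta> = 0")
  case False
  have \<alpha>: "cmod \<alpha> < 1" and sqrt: "sqrt (1 - (cmod \<alpha>)\<^sup>2) = cmod \<beta>"
  proof -
    have "0 < (cmod \<beta>)\<^sup>2" using False by simp
    then have "(cmod \<alpha>)\<^sup>2 < 1" using assms(1) by linarith
    then show "cmod \<alpha> < 1" by (simp add: abs_square_less_1)
    have "1 - (cmod \<alpha>)\<^sup>2 = (cmod \<beta>)\<^sup>2" using assms(1) by linarith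
    then show "sqrt (1 - (cmod \<alpha>)\<^sup>2) = cmod \<beta>" by simp
  qed
  note unique = psi_system_unique[OF \<alpha>]
  obtain c t where ct: "psi_system \<alpha> c t" using unique(1) by blast
  then have t: "t \<in> {0<..<2 * pi / sqrt (1 + c\<^sup>2)}" and chart: "chart (geodesic_point c t) = \<alpha>"
    using psi_system_iff[OF \<alpha>] by auto
  note facts = geodesic_point_facts[OF t]
  have t_eq: "t = psi \<alpha>"
    using facts(3) unchart_chart[OF facts(2)] by (simp add: unique(2) disc_dist_def chart)
  \<comment> \<open>\<open>c\<close> and \<open>t\<close> fix the modulus of the upper right entry
    but leave its phase free; \<open>\<omega>\<close> is the initial direction that produces the
    phase of \<open>\<beta>\<close>.\<close>
  define \<omega> where "\<omega> = \<beta> / (cis (c * t / 2) * of_real (cmod \<beta>))"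
  have "sin (sqrt (1 + c\<^sup>2) * t / 2) / sqrt (1 + c\<^sup>2) = cmod \<beta>"
    using ct sqrt by (simp add: psi_system_def)
  then have \<beta>_eq: "\<beta> = \<omega> * cis (c * t / 2) * of_real (sin (sqrt (1 + c\<^sup>2) * t / 2) / sqrt (1 + c\<^sup>2))"
    using False by (simp add: \<omega>_def)
  have \<alpha>_eq: "\<alpha> = cis (- (c * t / 2)) * geodesic_point c t"
    using chart unfolding chart_def facts(5) by (simp add: mult.commute)
  have "cmod \<omega> = 1"
    using False by (simp add: \<omega>_def norm_divide norm_mult)
  then obtain \<gamma> where
    "horizontal t \<gamma>" "\<gamma> 0 = su2_matrix \<alpha> \<beta>" "\<gamma> t = mat 1" "curve_length t \<gamma> = t"
    using geodesic_to_identity[OF _ _ \<alpha>_eq \<beta>_eq] t by auto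
  moreover have "((\<lambda>r. disc_dist (of_real r * \<alpha>)) \<longlongrightarrow> t) (at_left 1)"
  proof -
    obtain e where "(disc_dist has_derivative e) (at \<alpha>)"
      using has_derivative_disc_dist[OF \<alpha>] by metis
    then have "isCont disc_dist \<alpha>" by (rule has_derivative_continuous)
    then have "((\<lambda>r. disc_dist (of_real r * \<alpha>)) \<longlongrightarrow> disc_dist \<alpha>) (at_left 1)"
      by (rule isCont_tendsto_compose) (auto intro!: tendsto_eq_intros)
    then show ?thesis using t_eq unique(2) by simp
  qed
  then have "t \<le> curve_length T \<gamma>"
    if "horizontal T \<gamma>" "\<gamma> 0 = su2_matrix \<alpha> \<beta>" "\<gamma> T = mat 1" for T \<gamma>
    using curve_length_ge_limit[OF that] by blast
  ultimately have "sub_riemannian_dist (su2_matrix \<alpha> \<beta>) (mat 1) = t"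
    by (rule sub_riemannian_dist_eqI)
  then show ?thesis using False unique(1) t_eq by simp
next
  case True
  have "cmod \<alpha> = 1"
    using assms(1) True norm_ge_zero[of \<alpha>] by (auto simp: power2_eq_1_iff)
  then have \<alpha>: "\<alpha> = cis \<theta>"
    using assms(2) by (simp add: is_Arg_iff_rcis rcis_def)
  have "sub_riemannian_dist (su2_matrix \<alpha> \<beta>) (mat 1) = 2 * sqrt (\<theta> * (2 * pi - \<theta>))"
  \<comment> \<open>Both end values of \<open>\<theta>\<close> describe the identity, where the
    formula gives 0.\<close>
  proof (cases "\<theta> = 0 \<or> \<theta> = 2 * pi")
    case trivial: True
    then have "su2_matrix \<alpha> \<beta> = mat 1" "2 * sqrt (\<theta> * (2 * pi - \<theta>)) = 0"
      using True \<alpha> by (auto simp: mat_1_eq_su2_matrix)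
    then show ?thesis
      using constant_curve_at_identity sub_riemannian_dist_eqI curve_length_nonneg by metis
  next
    case False
    then have \<theta>: "0 < \<theta>" "\<theta> < 2 * pi" using assms(3) by auto
    \<comment> \<open>\<open>t\<close> and \<open>c\<close> solve sqrt (1 + c^2) t / 2 = pi, the
      return to the diagonal subgroup, and c t / 2 = pi - theta, the prescribed phase. Subtracting
      the squares gives t^2 = 4 theta (2 pi - theta).\<close>
    define t where "t = 2 * sqrt (\<theta> * (2 * pi - \<theta>))"
    define c where "c = 2 * (pi - \<theta>) / t"
    have t: "0 < t" "t\<^sup>2 = 4 * (\<theta> * (2 * pi - \<theta>))"
      using \<theta> by (auto simp: t_def power_mult_distrib)
    have "(1 + c\<^sup>2) * t\<^sup>2 = t\<^sup>2 + (2 * (pi - \<theta>))\<^sup>2"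
      using t(1) by (simp add: c_def field_simps power_divide)
    also have "\<dots> = (2 * pi)\<^sup>2"
      unfolding t(2) by (simp add: power2_eq_square algebra_simps)
    finally have "(sqrt (1 + c\<^sup>2) * t)\<^sup>2 = (2 * pi)\<^sup>2"
      by (simp add: power_mult_distrib)
    then have "sqrt (1 + c\<^sup>2) * t = 2 * pi"
      by (rule power2_eq_imp_eq) (use t(1) in auto)
    then have s: "sqrt (1 + c\<^sup>2) * t / 2 = pi" by simp
    have ct: "c * t / 2 = pi - \<theta>" using t(1) by (simp add: c_def)
    have "geodesic_point c t = - 1"
      by (simp add: geodesic_point_def s Let_def complex_eq_iff)
    then have \<alpha>_eq: "\<alpha> = cis (- (c * t / 2)) * geodesic_point c t"
      unfolding ct \<alpha> by (simp add: complex_eq_iff cos_diff sin_diff)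
    have \<beta>_eq: "\<beta> = 1 * cis (c * t / 2) * of_real (sin (sqrt (1 + c\<^sup>2) * t / 2) / sqrt (1 + c\<^sup>2))"
      unfolding s True by simp
    obtain \<gamma> where
      "horizontal t \<gamma>" "\<gamma> 0 = su2_matrix \<alpha> \<beta>" "\<gamma> t = mat 1" "curve_length t \<gamma> = t"
      using geodesic_to_identity[OF t(1) norm_one \<alpha>_eq \<beta>_eq] by auto
    moreover have "((\<lambda>r. disc_dist (of_real r * \<alpha>)) \<longlongrightarrow> t) (at_left 1)"
      using disc_dist_boundary[OF \<theta>] by (simp add: \<alpha> t_def rcis_def)
    then have "t \<le> curve_length T \<gamma>"
      if "horizontal T \<gamma>" "\<gamma> 0 = su2_matrix \<alpha> \<beta>" "\<gamma> T = mat 1" for T \<gamma>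
      using curve_length_ge_limit[OF that] by blast
    ultimately have "sub_riemannian_dist (su2_matrix \<alpha> \<beta>) (mat 1) = t"
      by (rule sub_riemannian_dist_eqI)
    then show ?thesis by (simp add: t_def)
  qed
  then show ?thesis using True by simp
qed

end
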